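(* Let $D_T$ be a regular $s^{n-k}$ design that is a projection design of $\tilde H_{n-k}$. If $D_T$ has minimum aberration (MA) among all ($n$-column) projection designs of $\tilde H_{n-k}$, then $D_T$ can be partitioned as an $(s^{n-k}:s^{n-k-1})$ RME design $D$ that has MA with respect to each of $W_{\mathrm{scf}}$, $W_1$, $W_2$ and $W_{\mathrm{cc}}$.
   Context: Let $s$ be a prime power, $GF(s)$ the field with $s$ elements, and $V_m$ the space of row vectors of length $m$ over $GF(s)$. Let $n,k$ be integers with $n\ge 1$, $k\ge0$, $n-k\ge2$; write $N=s^{n-k}$ and $L_q=(s^q-1)/(s-1)$. Designs. A regular $s^{n-k}$ design is the $N\times n$ matrix $D_T$ whose rows are the vectors $uT$, $u\in V_{n-k}$, where $T$ is an $(n-k)\times n$ matrix over $GF(s)$ of full row rank. A regular $(s^{n-k}:s^p)$ design $D$ is specified by such a $T$ together with an $(n-k)\times p$ matrix $B$ over $GF(s)$ of full column rank; its blocks are the sets $\{uT: u\in V_{n-k},\,uB=v\}$, one for each $v\in V_p$; $D$ is then said to be a partition of $D_T$ into $s^p$ blocks. If $b_1,\dots,b_p$ are the columns of $B$, let $F$ be the $(n-k)\times L_p$ matrix whose columns are all combinations $\lambda_1b_1+\cdots+\lambda_pb_p$ with $\lambda_i\in GF(s)$, not all zero, the first nonzero $\lambda_i$ being $1$. The design $\tilde H_{n-k}$. Let $\tilde F$ be an $(n-k-2)$-flat (i.e. a hyperplane) in the projective geometry $PG(n-k-1,s)$, and let $\tilde T$ be its complement in $PG(n-k-1,s)$; regard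 $\tilde T$ as a matrix with $n-k$ rows whose columns are (representatives of) the points of the complement. $\tilde H_{n-k}$ is the linear code generated by $\tilde T$, i.e. the $N$-row matrix with rows $u\tilde T$, $u\in V_{n-k}$ (unique up to isomorphism). A projection design of $\tilde H_{n-k}$ with $n$ columns is the matrix formed by $n$ distinct columns of $\tilde H_{n-k}$; here the projection designs considered are those that are regular $s^{n-k}$ designs (the chosen $n$ columns of $\tilde T$ have rank $n-k$). Wordlength patterns. Let $wt$ denote the Hamming weight. $A_{i,0}=(s-1)^{-1}\#\{w\in V_n: Tw'=0,\ wt(w)=i\}$ and $A_{i,1}=(s-1)^{-1}\#\{(w_1,w_2)\in V_n\times V_{L_p}: Tw_1'+Fw_2'=0,\ wt(w_1)=i,\ wt(w_2)=1\}$ (both are $0$ for $i>n$). $D$ is a regular main effect (RME) design if $A_{1,0}(D)=A_{2,0}(D)=A_{1,1}(D)=0$. Minimum aberration. A regular $s^{n-k}$ design has MA among a class of regular $s^{n-k}$ designs if it sequentially (lexicographically) minimizes $A_{1,0},A_{2,0},\dots,A_{n,0}$ over the class. For blocked designs, consider the sequences $W_{\mathrm{scf}}=(A_{3,0},A_{2,1},A_{4,0},A_{3,1},A_{5,0},A_{4,1},\dots)$ (successive pairs $A_{i+1,0},A_{i,1}$, $i=2,3,\dots$); $W_{\mathrm{cc}}=(3A_{3,0}+A_{2,1},A_{4,0},10A_{5,0}+A_{3,1},A_{6,0},\dots)$ (successive pairs $\binom{2i-1}{i}A_{2i-1,0}+A_{i,1},\ A_{2i,0}$, $i=2,3,\dots$);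 $W_1=(A_{3,0},A_{4,0},A_{2,1},A_{5,0},A_{6,0},A_{3,1},\dots)$ (successive triples $A_{2i-1,0},A_{2i,0},A_{i,1}$, $i=2,3,\dots$); $W_2=(A_{3,0},A_{2,1},A_{4,0},A_{5,0},A_{3,1},A_{6,0},\dots)$ (successive triples $A_{2i-1,0},A_{i,1},A_{2i,0}$, $i=2,3,\dots$). An $(s^{n-k}:s^p)$ RME design has MA with respect to one of these sequences $W$ if it lexicographically minimizes $W$ among all $(s^{n-k}:s^p)$ RME designs (same $s,n,k,p$). *)

theory Defs
  imports
    "Jordan_Normal_Form.DL_Rank"
    "HOL-Library.Cardinality"
    "HOL-Library.Disjoint_Sets"
    "HOL-Library.Fun_Lexorder"
begin

text \<open>
  The field with \<open>s\<close> elements is a finite field type \<open>'a\<close>, with \<open>s = CARD('a)\<close>. A row vector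
  \<open>u\<close> of length \<open>m\<close> is an element of \<^term>\<open>carrier_vec m\<close>, so that the product \<open>u T\<close> is
  \<^term>\<open>transpose_mat T *\<^sub>v u\<close>.
\<close>

definition vec_times_mat :: "'a::field vec \<Rightarrow> 'a mat \<Rightarrow> 'a vec" where
  "vec_times_mat u T = transpose_mat T *\<^sub>v u"

text \<open>
  An arbitrary enumeration of a finite set. It only fixes the order of the rows of a design and
  of the columns of \<open>F\<close> below, which is immaterial.
\<close>

definition enum_list :: "'b set \<Rightarrow> 'b list" where
  "enum_list S = (SOME xs. distinct xs \<and> set xs = S)"


subsection \<open>Designs\<close>

definition code_matrix :: "'a::{field,finite} mat \<Rightarrow> 'a mat" where
  "code_matrix T = mat_of_rows (dim_col T)
     (map (\<lambda>u. vec_times_mat u T) (enum_list (carrier_vec (dim_row T))))"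

definition regular_generators :: "nat \<Rightarrow> nat \<Rightarrow> 'a::field mat set" where
  "regular_generators m n = {T \<in> carrier_mat m n. vec_space.rank m T = m}"

text \<open>
  A blocked design is given by the pair \<open>(T, B)\<close> specifying it.
\<close>

definition blocked_designs ::
  "nat \<Rightarrow> nat \<Rightarrow> nat \<Rightarrow> ('a::field mat \<times> 'a mat) set" where
  "blocked_designs m n p =
     {(T, B). T \<in> regular_generators m n \<and> B \<in> carrier_mat m p \<and> vec_space.rank m B = p}"

definition blocks :: "'a::field mat \<times> 'a mat \<Rightarrow> 'a vec set set" where
  "blocks = (\<lambda>(T, B).
     {{vec_times_mat u T | u. u \<in> carrier_vec (dim_row T) \<and> vec_times_mat u B = v} | v.
        v \<in> carrier_vec (dim_col B)})"

text \<open>The coefficient vectors that are nonzero and whose first nonzero entry is \<open>1\<close>.\<close>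

definition normalized_vecs :: "nat \<Rightarrow> 'a::field vec set" where
  "normalized_vecs p = {l \<in> carrier_vec p. \<exists>i<p. l $ i = 1 \<and> (\<forall>j<i. l $ j = 0)}"

definition block_effects :: "'a::{field,finite} mat \<Rightarrow> 'a mat" where
  "block_effects B = mat_of_cols (dim_row B)
     (map (\<lambda>l. B *\<^sub>v l) (enum_list (normalized_vecs (dim_col B))))"


subsection \<open>The projective geometry and projection designs\<close>

definition proj_point :: "'a::field vec \<Rightarrow> 'a vec set" where
  "proj_point v = {c \<cdot>\<^sub>v v | c. True}"

text \<open>The points of \<open>PG(m - 1, s)\<close>.\<close>

definition proj_points :: "nat \<Rightarrow> 'a::field vec set set" where
  "proj_points m = proj_point ` (carrier_vec m - {0\<^sub>v m})"

text \<open>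
  A \<open>d\<close>-flat of \<open>PG(m - 1, s)\<close>, as a set of points, comes from a linear subspace of
  dimension \<open>d + 1\<close>.
\<close>

definition is_flat :: "nat \<Rightarrow> nat \<Rightarrow> 'a::field vec set set \<Rightarrow> bool" where
  "is_flat m d \<Phi> \<longleftrightarrow>
     (\<exists>W. VectorSpace.subspace class_ring W (module_vec TYPE('a) m) \<and>
          vectorspace.dim class_ring (module_vec TYPE('a) m\<lparr>carrier := W\<rparr>) = d + 1 \<and>
          \<Phi> = {P \<in> proj_points m. P \<subseteq> W})"

text \<open>The columns of \<open>M\<close> are representatives of the points in \<open>P\<close>, one for each point.\<close>

definition represents_points :: "nat \<Rightarrow> 'a::field mat \<Rightarrow> 'a vec set set \<Rightarrow> bool" where
  "represents_points m M P \<longleftrightarrow>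
     dim_row M = m \<and> bij_betw (\<lambda>j. proj_point (col M j)) {..<dim_col M} P"

definition is_projection :: "nat \<Rightarrow> 'b mat \<Rightarrow> 'b mat \<Rightarrow> bool" where
  "is_projection n H D \<longleftrightarrow>
     (\<exists>js. length js = n \<and> distinct js \<and> set js \<subseteq> {..<dim_col H} \<and>
           D = mat_of_cols (dim_row H) (map (col H) js))"

text \<open>
  The regular designs (given by their generators) that are projection designs of the code
  generated by \<open>M\<close>.
\<close>

definition projection_designs ::
  "nat \<Rightarrow> nat \<Rightarrow> 'a::{field,finite} mat \<Rightarrow> 'a mat set" where
  "projection_designs m n M =
     {T \<in> regular_generators m n. is_projection n (code_matrix M) (code_matrix T)}"


subsection \<open>Wordlength patterns\<close>

definition wt :: "'a::zero vec \<Rightarrow> nat" where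
  "wt w = card {i. i < dim_vec w \<and> w $ i \<noteq> 0}"

definition A0 :: "'a::{field,finite} mat \<Rightarrow> nat \<Rightarrow> real" where
  "A0 T i = real (card {w \<in> carrier_vec (dim_col T). T *\<^sub>v w = 0\<^sub>v (dim_row T) \<and> wt w = i})
              / (real CARD('a) - 1)"

definition A1 :: "'a::{field,finite} mat \<Rightarrow> 'a mat \<Rightarrow> nat \<Rightarrow> real" where
  "A1 T B i = real (card {(w1, w2).
       w1 \<in> carrier_vec (dim_col T) \<and> w2 \<in> carrier_vec (dim_col (block_effects B)) \<and>
       T *\<^sub>v w1 + block_effects B *\<^sub>v w2 = 0\<^sub>v (dim_row T) \<and> wt w1 = i \<and> wt w2 = 1})
     / (real CARD('a) - 1)"

definition RME_designs ::
  "nat \<Rightarrow> nat \<Rightarrow> nat \<Rightarrow> ('a::{field,finite} mat \<times> 'a mat) set" where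
  "RME_designs m n p =
     {(T, B) \<in> blocked_designs m n p. A0 T 1 = 0 \<and> A0 T 2 = 0 \<and> A1 T B 1 = 0}"


subsection \<open>Minimum aberration\<close>

text \<open>
  Sequences are indexed from \<open>0\<close> and continue with zeros: \<^term>\<open>A0 T i\<close> and \<^term>\<open>A1 T B i\<close>
  vanish once \<open>i\<close> exceeds the number of columns of \<open>T\<close>.
\<close>

definition lex_minimizes :: "('d \<Rightarrow> nat \<Rightarrow> real) \<Rightarrow> 'd set \<Rightarrow> 'd \<Rightarrow> bool" where
  "lex_minimizes W C D \<longleftrightarrow> D \<in> C \<and> (\<forall>D'\<in>C. \<not> less_fun (W D') (W D))"

definition regular_MA :: "'a::{field,finite} mat set \<Rightarrow> 'a mat \<Rightarrow> bool" where
  "regular_MA = lex_minimizes (\<lambda>T j. A0 T (j + 1))"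

text \<open>
  In the sequences below the consecutive groups of two or three terms belong to
  \<open>i = 2, 3, \<dots>\<close>.
\<close>

definition W_scf :: "'a::{field,finite} mat \<times> 'a mat \<Rightarrow> nat \<Rightarrow> real" where
  "W_scf = (\<lambda>(T, B) j. let i = j div 2 + 2 in
     [A0 T (i + 1), A1 T B i] ! (j mod 2))"

definition W_cc :: "'a::{field,finite} mat \<times> 'a mat \<Rightarrow> nat \<Rightarrow> real" where
  "W_cc = (\<lambda>(T, B) j. let i = j div 2 + 2 in
     [real ((2 * i - 1) choose i) * A0 T (2 * i - 1) + A1 T B i, A0 T (2 * i)] ! (j mod 2))"

definition W_1 :: "'a::{field,finite} mat \<times> 'a mat \<Rightarrow> nat \<Rightarrow> real" where
  "W_1 = (\<lambda>(T, B) j. let i = j div 3 + 2 in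
     [A0 T (2 * i - 1), A0 T (2 * i), A1 T B i] ! (j mod 3))"

definition W_2 :: "'a::{field,finite} mat \<times> 'a mat \<Rightarrow> nat \<Rightarrow> real" where
  "W_2 = (\<lambda>(T, B) j. let i = j div 3 + 2 in
     [A0 T (2 * i - 1), A1 T B i, A0 T (2 * i)] ! (j mod 3))"

definition RME_MA ::
  "('a::{field,finite} mat \<times> 'a mat \<Rightarrow> nat \<Rightarrow> real) \<Rightarrow> nat \<Rightarrow> nat \<Rightarrow> nat \<Rightarrow> 'a mat \<times> 'a mat \<Rightarrow> bool"
  where "RME_MA W m n p = lex_minimizes W (RME_designs m n p)"

end

theory Submission
  imports Defs "Berlekamp_Zassenhaus.Berlekamp_Type_Based"
begin

text \<open>
  Let \<open>m = n - k\<close>. Blocking into \<open>s\<^bsup>m - 1\<^esup>\<close> blocks means that the block effects fill a whole hyperplane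
  of \<open>PG(m - 1, s)\<close>, and such a blocked design is an RME design iff the columns of \<open>T\<close> are distinct
  points of the complement of this hyperplane. This has two consequences.

  First, up to projective equivalence, which does not affect the wordlength pattern, RME designs are
  the same as projection designs of the code generated by the complement of any fixed hyperplane. If
  \<open>T\<close> is a projection design, a basis of the fixed hyperplane is a suitable \<open>B\<close>
  (\<open>projection_design_is_RME\<close>). Conversely, a linear map takes the hyperplane of an arbitrary RME
  design to the fixed one (\<open>RME_equivalent_projection_design\<close>). So a projection design that
  lexicographically minimizes \<open>A0\<close> among projection designs does so among RME designs as well.

  Second, \<open>A1\<close> is determined by \<open>A0\<close>. The hyperplane is the kernel of a linear form that does not
  vanish at any column of \<open>T\<close>; after rescaling the coordinates, the words \<open>w\<close> for which \<open>T w\<close> lies in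
  the hyperplane are those with coordinate sum zero. Their number of weight \<open>i\<close> is a constant, and it
  counts the words contributing to \<open>A1\<close> together with those contributing to \<open>A0\<close>. Thus
  \<open>A1 T B i = z i - A0 T i\<close> with the same \<open>z\<close> for all RME designs (\<open>A1_eq\<close>).

  In each of the four sequences, \<open>A0\<close> at a given index precedes all terms that involve \<open>A1\<close> at that
  index, or is zero throughout the class. Therefore the first difference between two sequences occurs
  where \<open>A0\<close> first differs, all the criteria rank the RME designs as \<open>A0\<close> does
  (\<open>RME_MA_of_A0_minimal\<close>), and a minimizer of \<open>A0\<close> is a minimizer of them all.
\<close>

section \<open>Finite subspaces and ranks of matrices\<close>

text \<open>
  The set \<open>vec_space.col_space\<close>, in a form that mentions neither a dimension nor a span.
  Over a finite field its cardinality is a power of the field size with the rank as exponent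
  (\<open>card_mat_range\<close> below), which turns rank conditions into statements about injective and
  surjective maps between finite sets.
\<close>

definition mat_range :: "'a::field mat \<Rightarrow> 'a vec set" where
  "mat_range A = (\<lambda>v. A *\<^sub>v v) ` carrier_vec (dim_col A)"

text \<open>
  With respect to a basis, vectors correspond bijectively to functions from the basis to the field.
\<close>

lemma (in vectorspace) card_carrier_eq_power_dim:
  assumes "finite (carrier V)"
  shows "card (carrier V) = card (carrier K) ^ dim"
proof -
  have fd: "fin_dim"
    unfolding fin_dim_def using assms in_own_span[of "carrier V"] span_is_subset2[of "carrier V"] by blast
  obtain A where A: "finite A" "basis A"
    using finite_basis_exists[OF fd] by blast
  have AV: "A \<subseteq> carrier V" using A by (simp add: basis_def)
  have *: "\<exists>!a. a \<in> A \<rightarrow>\<^sub>E carrier K \<and> lincomb a A = v" if "v \<in> carrier V" for v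
    using that A basis_criterion[OF A(1) AV] by blast
  have "bij_betw (\<lambda>a. lincomb a A) (A \<rightarrow>\<^sub>E carrier K) (carrier V)"
    unfolding bij_betw_def
  proof
    have car: "lincomb a A \<in> carrier V" if "a \<in> A \<rightarrow>\<^sub>E carrier K" for a
      using that AV by (intro lincomb_closed) (auto simp: PiE_def)
    then show "inj_on (\<lambda>a. lincomb a A) (A \<rightarrow>\<^sub>E carrier K)"
      by (intro inj_onI) (metis *)
    show "(\<lambda>a. lincomb a A) ` (A \<rightarrow>\<^sub>E carrier K) = carrier V"
      using car * by (auto simp: image_iff) metis
  qed
  then have "card (carrier V) = card (A \<rightarrow>\<^sub>E carrier K)"
    using bij_betw_same_card by fastforce
  also have "\<dots> = card (carrier K) ^ card A"
    using A(1) by (simp add: card_PiE)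
  finally show ?thesis
    using dim_basis[OF A] by simp
qed

lemma card_subspace_eq_power_dim:
  fixes W :: "'a::{field,finite} vec set"
  assumes "VectorSpace.subspace class_ring W (module_vec TYPE('a) m)"
  shows "card W = CARD('a) ^ vectorspace.dim class_ring (module_vec TYPE('a) m\<lparr>carrier := W\<rparr>)"
proof -
  interpret vec_space "TYPE('a)" m .
  have vs: "vectorspace class_ring (vs W)"
    using subspace_is_vs[OF assms] .
  have "W \<subseteq> carrier_vec m"
    using submodule.subset[OF is_module[OF assms]] by simp
  then have "finite (carrier (vs W))"
    by (simp add: finite_subset)
  from vectorspace.card_carrier_eq_power_dim[OF vs this] show ?thesis
    by simp
qed

lemma (in vec_space) span_cols_eq_mat_range:
  assumes "A \<in> carrier_mat n p"
  shows "span (set (cols A)) = mat_range A"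
  using col_space_eq[OF assms] assms unfolding col_space_def mat_range_def by auto

lemma mat_range_subspace:
  fixes A :: "'a::field mat"
  assumes "A \<in> carrier_mat m p"
  shows "VectorSpace.subspace class_ring (mat_range A) (module_vec TYPE('a) m)"
    and "vec_space.rank m A = vectorspace.dim class_ring (module_vec TYPE('a) m\<lparr>carrier := mat_range A\<rparr>)"
proof -
  interpret vec_space "TYPE('a)" m .
  have c: "set (cols A) \<subseteq> carrier_vec m"
    using assms cols_dim[of A] by auto
  have eq: "span (set (cols A)) = mat_range A"
    using span_cols_eq_mat_range[OF assms] .
  show "subspace class_ring (mat_range A) V"
    using span_is_subspace[of "set (cols A)"] c eq by simp
  show "rank A = vectorspace.dim class_ring (vs (mat_range A))"
    unfolding rank_def eq ..
qed

lemma card_mat_range: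
  fixes A :: "'a::{field,finite} mat"
  assumes "A \<in> carrier_mat m p"
  shows "card (mat_range A) = CARD('a) ^ vec_space.rank m A"
  using card_subspace_eq_power_dim[OF mat_range_subspace(1)[OF assms]] mat_range_subspace(2)[OF assms]
  by simp

text \<open>
  The columns of \<open>B\<close> are a basis of \<open>W\<close>. Applied to the hyperplane removed from the projective
  geometry, this produces the blocking matrix of the theorem.
\<close>

lemma subspace_eq_mat_range:
  fixes W :: "'a::{field,finite} vec set"
  assumes "VectorSpace.subspace class_ring W (module_vec TYPE('a) m)"
    and "vectorspace.dim class_ring (module_vec TYPE('a) m\<lparr>carrier := W\<rparr>) = d"
  obtains B where "B \<in> carrier_mat m d" and "vec_space.rank m B = d" and "mat_range B = W"
proof -
  interpret vec_space "TYPE('a)" m .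
  interpret W: vectorspace class_ring "vs W"
    using subspace_is_vs[OF assms(1)] .
  have sub: "submodule class_ring W V"
    using is_module[OF assms(1)] .
  then have Wm: "W \<subseteq> carrier_vec m"
    using submodule.subset by fastforce
  have "finite W" using Wm by (simp add: finite_subset)
  then have "W.fin_dim"
    unfolding W.fin_dim_def using W.in_own_span[of W] W.span_is_subset2[of W] by auto
  then obtain S where S: "finite S" "W.basis S"
    using W.finite_basis_exists by blast
  have SW: "S \<subseteq> W" and gen: "W.span S = W" using S by (auto simp: W.basis_def)
  have card: "card S = d" using W.dim_basis[OF S] assms(2) by simp
  obtain xs where xs: "set xs = S" "distinct xs"
    using finite_distinct_list[OF S(1)] by blast
  have len: "length xs = d" using card xs distinct_card by fastforce
  have xsm: "set xs \<subseteq> carrier_vec m" using xs SW Wm by auto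
  let ?B = "mat_of_cols m xs"
  have B: "?B \<in> carrier_mat m d" using len by auto
  have "span S = W"
    using span_li_not_depend(1)[OF SW sub] gen by simp
  then have col: "mat_range ?B = W"
    using span_cols_eq_mat_range[OF B] xs xsm by simp
  moreover have "rank ?B = d"
    using mat_range_subspace(2)[OF B] col assms(2) by simp
  ultimately show ?thesis using that B by blast
qed

lemma one_less_card_field: "CARD('a::{field,finite}) > 1"
  using card_mono[of "UNIV :: 'a set" "{0, 1}"] by simp

lemma mat_range_subset: "A \<in> carrier_mat m p \<Longrightarrow> mat_range A \<subseteq> carrier_vec m"
  by (auto simp: mat_range_def)

lemma full_column_rank_imp_inj:
  fixes B :: "'a::{field,finite} mat"
  assumes "B \<in> carrier_mat m p" and "vec_space.rank m B = p"
  shows "inj_on (\<lambda>v. B *\<^sub>v v) (carrier_vec p)"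
proof (rule eq_card_imp_inj_on)
  show "card ((\<lambda>v. B *\<^sub>v v) ` carrier_vec p) = card (carrier_vec p :: 'a vec set)"
    using card_mat_range[OF assms(1)] assms by (simp add: mat_range_def card_carrier_vec)
qed simp

lemma full_row_rank_iff_surj:
  fixes T :: "'a::{field,finite} mat"
  assumes "T \<in> carrier_mat m n"
  shows "vec_space.rank m T = m \<longleftrightarrow> mat_range T = carrier_vec m"
proof
  assume "vec_space.rank m T = m"
  then have "card (mat_range T) = card (carrier_vec m :: 'a vec set)"
    using card_mat_range[OF assms] by (simp add: card_carrier_vec)
  then show "mat_range T = carrier_vec m"
    using mat_range_subset[OF assms] by (intro card_subset_eq) auto
next
  assume "mat_range T = carrier_vec m"
  then have "CARD('a) ^ vec_space.rank m T = CARD('a) ^ m"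
    using card_mat_range[OF assms] by (simp add: card_carrier_vec)
  moreover have "CARD('a) > 1"
    by (rule one_less_card_field)
  ultimately show "vec_space.rank m T = m" by simp
qed

text \<open>
  If \<open>u T = v T\<close>, then \<open>u\<close> and \<open>v\<close> have the same scalar product with every \<open>T w\<close>, that is, with every
  vector. So the \<open>s\<^sup>m\<close> runs of a regular design are distinct, as the blocks need in order to be disjoint.
\<close>

lemma full_row_rank_imp_transpose_inj:
  fixes T :: "'a::{field,finite} mat"
  assumes T: "T \<in> carrier_mat m n" and r: "vec_space.rank m T = m"
  shows "inj_on (\<lambda>u. vec_times_mat u T) (carrier_vec m)"
proof (rule inj_onI)
  fix u v :: "'a vec"
  assume uv: "u \<in> carrier_vec m" "v \<in> carrier_vec m" and eq: "vec_times_mat u T = vec_times_mat v T"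
  have "u \<bullet> x = v \<bullet> x" if x: "x \<in> carrier_vec m" for x
  proof -
    obtain w where w: "w \<in> carrier_vec n" "x = T *\<^sub>v w"
      using x r full_row_rank_iff_surj[OF T] T by (auto simp: mat_range_def image_iff)
    have "u \<bullet> x = (transpose_mat T *\<^sub>v u) \<bullet> w"
      using transpose_vec_mult_scalar[OF T w(1) uv(1)] w by simp
    also have "\<dots> = (transpose_mat T *\<^sub>v v) \<bullet> w"
      using eq by (simp add: vec_times_mat_def)
    also have "\<dots> = v \<bullet> x"
      using transpose_vec_mult_scalar[OF T w(1) uv(2)] w by simp
    finally show ?thesis .
  qed
  then have "u $ i = v $ i" if "i < m" for i
    using that uv by (metis scalar_prod_right_unit unit_vec_carrier)
  then show "u = v" using uv by auto
qed

section \<open>Coordinates adapted to a hyperplane\<close>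

lemma append_column_mult_vec:
  fixes B :: "'a::field mat"
  assumes B: "B \<in> carrier_mat m d" and c: "c \<in> carrier_vec m" and y: "y \<in> carrier_vec d"
  shows "mat_of_cols m (cols B @ [c]) *\<^sub>v vec (Suc d) (\<lambda>i. if i < d then y $ i else l)
    = B *\<^sub>v y + l \<cdot>\<^sub>v c"
proof (rule eq_vecI)
  show "dim_vec (mat_of_cols m (cols B @ [c]) *\<^sub>v vec (Suc d) (\<lambda>i. if i < d then y $ i else l))
    = dim_vec (B *\<^sub>v y + l \<cdot>\<^sub>v c)" using c by simp
  fix i assume "i < dim_vec (B *\<^sub>v y + l \<cdot>\<^sub>v c)"
  then have i: "i < m" using c by simp
  have "(\<Sum>j = 0..<d. mat_of_cols m (cols B @ [c]) $$ (i, j) * y $ j) = (\<Sum>j = 0..<d. B $$ (i, j) * y $ j)"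
    using i B by (intro sum.cong) (auto simp: mat_of_cols_def nth_append)
  then show "(mat_of_cols m (cols B @ [c]) *\<^sub>v vec (Suc d) (\<lambda>i. if i < d then y $ i else l)) $ i
      = (B *\<^sub>v y + l \<cdot>\<^sub>v c) $ i"
    using i B c y by (simp add: scalar_prod_def mat_of_cols_def nth_append row_def)
qed

text \<open>
  A column \<open>c\<close> outside the hyperplane completes \<open>B\<close> to an invertible matrix \<open>P\<close>. Its inverse \<open>Q\<close>
  computes coordinates in which the hyperplane is the zero set of the last one. The last row of \<open>Q\<close>
  is thus a linear form defining the hyperplane, and two hyperplanes are exchanged by the product of
  one \<open>P\<close> and another \<open>Q\<close>.
\<close>

lemma hyperplane_coordinates:
  fixes B :: "'a::{field,finite} mat"
  assumes B: "B \<in> carrier_mat (Suc d) d" and r: "vec_space.rank (Suc d) B = d"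
  obtains P Q where "P \<in> carrier_mat (Suc d) (Suc d)" and "Q \<in> carrier_mat (Suc d) (Suc d)"
    and "P * Q = 1\<^sub>m (Suc d)" and "Q * P = 1\<^sub>m (Suc d)"
    and "\<And>y. y \<in> carrier_vec d \<Longrightarrow>
      Q *\<^sub>v (B *\<^sub>v y) = vec (Suc d) (\<lambda>i. if i < d then y $ i else 0)"
    and "\<And>x. x \<in> carrier_vec (Suc d) \<Longrightarrow> x \<in> mat_range B \<longleftrightarrow> (Q *\<^sub>v x) $ d = 0"
proof -
  let ?m = "Suc d"
  have s: "CARD('a) > 1"
    by (rule one_less_card_field)
  have "card (mat_range B) \<noteq> card (carrier_vec ?m :: 'a vec set)"
    using card_mat_range[OF B] r s by (simp add: card_carrier_vec)
  then have "mat_range B \<noteq> carrier_vec ?m" by metis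
  then obtain c where c: "c \<in> carrier_vec ?m" "c \<notin> mat_range B"
    using mat_range_subset[OF B] by blast
  \<comment> \<open>As \<open>c\<close> is not in the range of \<open>B\<close>, a nonzero multiple of \<open>c\<close> cannot cancel any \<open>B y\<close>, so \<open>P\<close> is injective.\<close>
  define P where "P = mat_of_cols ?m (cols B @ [c])"
  have P: "P \<in> carrier_mat ?m ?m"
    using B by (auto simp: P_def)
  have mult: "P *\<^sub>v v = B *\<^sub>v vec d (\<lambda>i. v $ i) + (v $ d) \<cdot>\<^sub>v c" if "v \<in> carrier_vec ?m" for v
  proof -
    have "v = vec (Suc d) (\<lambda>i. if i < d then vec d (\<lambda>i. v $ i) $ i else v $ d)"
      using that by (auto simp: less_Suc_eq)
    then show ?thesis
      unfolding P_def using append_column_mult_vec[OF B c(1), of "vec d (\<lambda>i. v $ i)" "v $ d"] by simp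
  qed
  have smult_zero: "0 \<cdot>\<^sub>v c = 0\<^sub>v ?m"
    using c by (intro eq_vecI) auto
  have "det P \<noteq> 0"
  proof
    assume "det P = 0"
    then obtain v where v: "v \<in> carrier_vec ?m" "v \<noteq> 0\<^sub>v ?m" "P *\<^sub>v v = 0\<^sub>v ?m"
      using det_0_iff_vec_prod_zero_field[OF P] by auto
    let ?y = "vec d (\<lambda>i. v $ i)"
    have eq: "B *\<^sub>v ?y + (v $ d) \<cdot>\<^sub>v c = 0\<^sub>v ?m"
      using mult v by simp
    have vd: "v $ d = 0"
    proof (rule ccontr)
      assume l: "v $ d \<noteq> 0"
      have "B *\<^sub>v ((- inverse (v $ d)) \<cdot>\<^sub>v ?y) = (- inverse (v $ d)) \<cdot>\<^sub>v (B *\<^sub>v ?y)"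
        using mult_mat_vec[OF B, of ?y] by simp
      also have "\<dots> = c"
      proof (rule eq_vecI)
        fix i assume i: "i < dim_vec c"
        have "(B *\<^sub>v ?y + (v $ d) \<cdot>\<^sub>v c) $ i = 0" using eq i c by simp
        then have "(B *\<^sub>v ?y) $ i + v $ d * c $ i = 0" using i c B by simp
        then have "(B *\<^sub>v ?y) $ i = - (v $ d * c $ i)" by (simp add: eq_neg_iff_add_eq_0)
        then show "(- inverse (v $ d) \<cdot>\<^sub>v (B *\<^sub>v ?y)) $ i = c $ i"
          using i c B l by (simp del: index_mult_mat_vec)
      qed (use B c in auto)
      finally have "c \<in> mat_range B"
        unfolding mat_range_def using B by (metis (no_types, lifting) carrier_matD(2) image_eqI smult_carrier_vec vec_carrier)
      with c show False by simp
    qed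
    from this have "B *\<^sub>v ?y = 0\<^sub>v ?m"
      using eq B c smult_zero by (metis mult_mat_vec_carrier right_zero_vec vec_carrier)
    moreover have "B *\<^sub>v 0\<^sub>v d = 0\<^sub>v ?m" using B by (intro eq_vecI) auto
    ultimately have "B *\<^sub>v ?y = B *\<^sub>v 0\<^sub>v d" by simp
    then have "?y = 0\<^sub>v d"
      using full_column_rank_imp_inj[OF B r] by (auto simp: inj_on_def)
    then have "v $ i = 0" if "i < d" for i
      using that by (metis index_vec index_zero_vec(1))
    with vd have "v = 0\<^sub>v ?m"
      using v(1) by (intro eq_vecI) (auto simp: less_Suc_eq)
    with v show False by simp
  qed
  from det_non_zero_imp_unit[OF P this, where b = "()"]
  obtain Q where Q: "Q \<in> carrier_mat ?m ?m" "P * Q = 1\<^sub>m ?m" "Q * P = 1\<^sub>m ?m"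
    unfolding Units_def ring_mat_def by auto
  have QB: "Q *\<^sub>v (B *\<^sub>v y) = vec ?m (\<lambda>i. if i < d then y $ i else 0)"
    if y: "y \<in> carrier_vec d" for y
  proof -
    let ?v = "vec ?m (\<lambda>i. if i < d then y $ i else 0)"
    have "P *\<^sub>v ?v = B *\<^sub>v y"
      unfolding P_def append_column_mult_vec[OF B c(1) y] using y B c by auto
    then have "Q *\<^sub>v (B *\<^sub>v y) = (Q * P) *\<^sub>v ?v"
      using P Q by (subst assoc_mult_mat_vec) auto
    then show ?thesis using Q by simp
  qed
  have "x \<in> mat_range B \<longleftrightarrow> (Q *\<^sub>v x) $ d = 0" if x: "x \<in> carrier_vec ?m" for x
  proof
    assume "x \<in> mat_range B"
    then obtain y where y: "y \<in> carrier_vec d" "x = B *\<^sub>v y"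
      using B by (auto simp: mat_range_def)
    show "(Q *\<^sub>v x) $ d = 0" unfolding y(2) QB[OF y(1)] by simp
  next
    assume 0: "(Q *\<^sub>v x) $ d = 0"
    have "x = P *\<^sub>v (Q *\<^sub>v x)"
      using P Q x by (metis assoc_mult_mat_vec one_mult_mat_vec)
    also have "\<dots> = B *\<^sub>v vec d (\<lambda>i. (Q *\<^sub>v x) $ i)"
      using mult[of "Q *\<^sub>v x"] 0 Q x B c by auto
    finally show "x \<in> mat_range B"
      unfolding mat_range_def using B by auto
  qed
  then show ?thesis using that[OF P Q QB] by blast
qed

text \<open>
  Since \<open>Q\<close> sends \<open>B y\<close> to \<open>y\<close> padded by \<open>0\<close>, the vector \<open>v\<close> is attained at \<open>u = (v, 0) Q\<close>.
\<close>

lemma hyperplane_transpose_surj: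
  fixes B :: "'a::{field,finite} mat"
  assumes B: "B \<in> carrier_mat (Suc d) d" and r: "vec_space.rank (Suc d) B = d"
    and v: "v \<in> carrier_vec d"
  obtains u where "u \<in> carrier_vec (Suc d)" and "vec_times_mat u B = v"
proof -
  obtain P Q where Q: "Q \<in> carrier_mat (Suc d) (Suc d)"
    and QB: "\<And>y. y \<in> carrier_vec d \<Longrightarrow>
      Q *\<^sub>v (B *\<^sub>v y) = vec (Suc d) (\<lambda>i. if i < d then y $ i else 0)"
    using hyperplane_coordinates[OF B r] by metis
  define v' where "v' = vec (Suc d) (\<lambda>i. if i < d then v $ i else 0)"
  have v': "v' \<in> carrier_vec (Suc d)" by (simp add: v'_def)
  let ?u = "transpose_mat Q *\<^sub>v v'"
  have u: "?u \<in> carrier_vec (Suc d)" using Q v' by simp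
  have "vec_times_mat ?u B $ i = v $ i" if i: "i < d" for i
  proof -
    let ?e = "unit_vec d i :: 'a vec"
    have e: "?e \<in> carrier_vec d" by simp
    have Be: "B *\<^sub>v ?e \<in> carrier_vec (Suc d)" using B e by simp
    have "vec_times_mat ?u B $ i = (transpose_mat B *\<^sub>v ?u) \<bullet> ?e"
      using i B by (simp add: vec_times_mat_def)
    also have "\<dots> = ?u \<bullet> (B *\<^sub>v ?e)"
      using transpose_vec_mult_scalar[OF B e u] .
    also have "\<dots> = v' \<bullet> (Q *\<^sub>v (B *\<^sub>v ?e))"
      using transpose_vec_mult_scalar[OF Q Be v'] .
    also have "Q *\<^sub>v (B *\<^sub>v ?e) = unit_vec (Suc d) i"
      unfolding QB[OF e] using i by (intro eq_vecI) (auto simp: less_Suc_eq)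
    also have "v' \<bullet> unit_vec (Suc d) i = v $ i" using i by (simp add: v'_def)
    finally show ?thesis .
  qed
  then have "vec_times_mat ?u B = v"
    using v B by (intro eq_vecI) (auto simp: vec_times_mat_def)
  with u show ?thesis using that by blast
qed

section \<open>Rescaling columns preserves the wordlength pattern\<close>

definition scale_vec :: "(nat \<Rightarrow> 'a) \<Rightarrow> 'a::field vec \<Rightarrow> 'a vec" where
  "scale_vec q w = vec (dim_vec w) (\<lambda>j. q j * w $ j)"

lemma scale_vec_carrier [simp]: "w \<in> carrier_vec n \<Longrightarrow> scale_vec q w \<in> carrier_vec n"
  by (simp add: scale_vec_def)

lemma wt_scale_vec:
  assumes "w \<in> carrier_vec n" and "\<And>j. j < n \<Longrightarrow> q j \<noteq> 0"
  shows "wt (scale_vec q w) = wt w"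
  unfolding wt_def using assms by (intro arg_cong[of _ _ card]) (auto simp: scale_vec_def)

lemma bij_betw_scale_vec:
  assumes "\<And>j. j < n \<Longrightarrow> q j \<noteq> 0"
  shows "bij_betw (scale_vec q) (carrier_vec n) (carrier_vec n)"
  by (rule bij_betwI[where g = "scale_vec (\<lambda>j. inverse (q j))"])
    (use assms in \<open>auto simp: scale_vec_def\<close>)

lemma scale_vec_surj:
  assumes "\<And>j. j < n \<Longrightarrow> q j \<noteq> 0" and "w \<in> carrier_vec n"
  obtains w' where "w' \<in> carrier_vec n" and "w = scale_vec q w'"
  using bij_betw_imp_surj_on[OF bij_betw_scale_vec[of n q]] assms by blast

text \<open>
  Multiplying coordinates by nonzero factors permutes the words of each weight, so a rescaled
  condition on words of weight \<open>i\<close> has as many solutions as the original one.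
\<close>

lemma card_scale_vec:
  assumes q: "\<And>j. j < n \<Longrightarrow> q j \<noteq> 0"
  shows "card {w \<in> carrier_vec n. Q (scale_vec q w) \<and> wt w = i} = card {w \<in> carrier_vec n. Q w \<and> wt w = i}"
proof (rule bij_betw_same_card)
  show "bij_betw (scale_vec q) {w \<in> carrier_vec n. Q (scale_vec q w) \<and> wt w = i} {w \<in> carrier_vec n. Q w \<and> wt w = i}"
    (is "bij_betw _ ?A ?B")
  proof (rule bij_betw_subset[OF bij_betw_scale_vec[OF q]])
    show "?A \<subseteq> carrier_vec n" by auto
    show "scale_vec q ` ?A = ?B"
    proof
      show "scale_vec q ` ?A \<subseteq> ?B"
        using wt_scale_vec[OF _ q] by auto
      show "?B \<subseteq> scale_vec q ` ?A"
      proof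
        fix w assume w: "w \<in> ?B"
        then obtain w' where "w' \<in> carrier_vec n" "w = scale_vec q w'"
          using scale_vec_surj[of n q w, OF q] by blast
        then show "w \<in> scale_vec q ` ?A"
          using w wt_scale_vec[OF _ q] by auto
      qed
    qed
  qed auto
qed

lemma scaled_columns_mult_vec:
  fixes T :: "'a::field mat"
  assumes T: "T \<in> carrier_mat m n" and T': "T' \<in> carrier_mat m n" and G: "G \<in> carrier_mat m m"
    and col: "\<And>j. j < n \<Longrightarrow> col T' j = q j \<cdot>\<^sub>v (G *\<^sub>v col T j)"
    and w: "w \<in> carrier_vec n"
  shows "T' *\<^sub>v w = G *\<^sub>v (T *\<^sub>v scale_vec q w)"
proof -
  have GT: "G * T \<in> carrier_mat m n" using G T by simp
  have "T' *\<^sub>v w = (G * T) *\<^sub>v scale_vec q w"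
  proof (rule eq_vecI)
    fix i assume "i < dim_vec ((G * T) *\<^sub>v scale_vec q w)"
    then have i: "i < m" using G by simp
    have "T' $$ (i, j) = q j * (G * T) $$ (i, j)" if j: "j < n" for j
    proof -
      have "T' $$ (i, j) = col T' j $ i" using i j T' by simp
      also have "\<dots> = q j * (G *\<^sub>v col T j) $ i" using col[OF j] i G T by simp
      also have "(G *\<^sub>v col T j) $ i = (G * T) $$ (i, j)" using i j G T by simp
      finally show ?thesis .
    qed
    then show "(T' *\<^sub>v w) $ i = ((G * T) *\<^sub>v scale_vec q w) $ i"
      using i w T' GT G by (auto simp: scalar_prod_def scale_vec_def simp del: index_mult_mat(1) intro!: sum.cong)
  qed (use T' G in auto)
  then show ?thesis
    using assoc_mult_mat_vec[OF G T scale_vec_carrier[OF w]] by simp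
qed

lemma inverse_mult_vec:
  fixes G :: "'a::field mat"
  assumes "H \<in> carrier_mat m m" "G \<in> carrier_mat m m" "H * G = 1\<^sub>m m" "x \<in> carrier_vec m"
  shows "H *\<^sub>v (G *\<^sub>v x) = x"
  using assms by (metis assoc_mult_mat_vec one_mult_mat_vec)

text \<open>
  The projective equivalence used to compare designs: an invertible map is applied to all columns
  and then each of them is replaced by a nonzero multiple. The words of one design are rescaled words of the
  other.
\<close>

lemma A0_scaled_columns:
  fixes T :: "'a::{field,finite} mat"
  assumes T: "T \<in> carrier_mat m n" and T': "T' \<in> carrier_mat m n"
    and G: "G \<in> carrier_mat m m" "H \<in> carrier_mat m m" "H * G = 1\<^sub>m m"
    and q: "\<And>j. j < n \<Longrightarrow> q j \<noteq> 0"
    and col: "\<And>j. j < n \<Longrightarrow> col T' j = q j \<cdot>\<^sub>v (G *\<^sub>v col T j)"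
  shows "A0 T' i = A0 T i"
proof -
  have "T' *\<^sub>v w = 0\<^sub>v m \<longleftrightarrow> T *\<^sub>v scale_vec q w = 0\<^sub>v m" if w: "w \<in> carrier_vec n" for w
  proof -
    have c: "T *\<^sub>v scale_vec q w \<in> carrier_vec m" using T w by simp
    have "H *\<^sub>v 0\<^sub>v m = 0\<^sub>v m" "G *\<^sub>v 0\<^sub>v m = 0\<^sub>v m" using G by auto
    then show ?thesis
      using scaled_columns_mult_vec[OF T T' G(1) col w] inverse_mult_vec[OF G(2,1,3) c]
      by metis
  qed
  then have "card {w \<in> carrier_vec n. T' *\<^sub>v w = 0\<^sub>v m \<and> wt w = i}
      = card {w \<in> carrier_vec n. T *\<^sub>v scale_vec q w = 0\<^sub>v m \<and> wt w = i}"
    by (intro arg_cong[of _ _ card]) auto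
  also have "\<dots> = card {w \<in> carrier_vec n. T *\<^sub>v w = 0\<^sub>v m \<and> wt w = i}"
    using card_scale_vec[OF q, where Q = "\<lambda>w. T *\<^sub>v w = 0\<^sub>v m"] by simp
  finally show ?thesis
    using T T' by (simp add: A0_def)
qed

lemma regular_generators_scaled_columns:
  fixes T :: "'a::{field,finite} mat"
  assumes T: "T \<in> regular_generators m n" and T': "T' \<in> carrier_mat m n"
    and G: "G \<in> carrier_mat m m" "H \<in> carrier_mat m m" "G * H = 1\<^sub>m m"
    and q: "\<And>j. j < n \<Longrightarrow> q j \<noteq> 0"
    and col: "\<And>j. j < n \<Longrightarrow> col T' j = q j \<cdot>\<^sub>v (G *\<^sub>v col T j)"
  shows "T' \<in> regular_generators m n"
proof -
  have Tc: "T \<in> carrier_mat m n" and r: "vec_space.rank m T = m"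
    using T by (auto simp: regular_generators_def)
  have "x \<in> mat_range T'" if x: "x \<in> carrier_vec m" for x
  proof -
    have "H *\<^sub>v x \<in> mat_range T"
      using full_row_rank_iff_surj[OF Tc] r G x by simp
    then obtain w where w: "w \<in> carrier_vec n" "H *\<^sub>v x = T *\<^sub>v w"
      using Tc by (auto simp: mat_range_def)
    then obtain w' where w': "w' \<in> carrier_vec n" "w = scale_vec q w'"
      using scale_vec_surj[of n q w, OF q] by blast
    have "T' *\<^sub>v w' = G *\<^sub>v (H *\<^sub>v x)"
      using scaled_columns_mult_vec[OF Tc T' G(1) col w'(1)] w w' by simp
    also have "\<dots> = x" using inverse_mult_vec[OF G x] .
    finally show ?thesis using w' T' by (auto simp: mat_range_def)
  qed
  then have "mat_range T' = carrier_vec m"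
    using mat_range_subset[OF T'] by blast
  then show ?thesis
    using full_row_rank_iff_surj[OF T'] T' by (simp add: regular_generators_def)
qed

section \<open>Words of weight one and two\<close>

lemma mult_smult_unit_vec:
  fixes A :: "'a::field mat"
  assumes "A \<in> carrier_mat m n" "j < n"
  shows "A *\<^sub>v (c \<cdot>\<^sub>v unit_vec n j) = c \<cdot>\<^sub>v col A j"
  using assms by (intro eq_vecI) (auto simp: scalar_prod_def sum.delta if_distrib if_distribR cong: if_cong)

lemma wt_eq_1_iff:
  fixes w :: "'a::field vec"
  assumes "w \<in> carrier_vec n"
  shows "wt w = 1 \<longleftrightarrow> (\<exists>j<n. \<exists>c. c \<noteq> 0 \<and> w = c \<cdot>\<^sub>v unit_vec n j)"
proof
  assume "wt w = 1"
  then obtain j where j: "{i. i < dim_vec w \<and> w $ i \<noteq> 0} = {j}"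
    unfolding wt_def by (auto simp: card_1_singleton_iff)
  then have jn: "j < n" "w $ j \<noteq> 0" and "\<And>i. i < n \<Longrightarrow> i \<noteq> j \<Longrightarrow> w $ i = 0"
    using assms by auto
  then have "w = w $ j \<cdot>\<^sub>v unit_vec n j"
    using assms by (intro eq_vecI) auto
  with jn show "\<exists>j<n. \<exists>c. c \<noteq> 0 \<and> w = c \<cdot>\<^sub>v unit_vec n j" by blast
next
  assume "\<exists>j<n. \<exists>c. c \<noteq> 0 \<and> w = c \<cdot>\<^sub>v unit_vec n j"
  then obtain j c where "j < n" "c \<noteq> 0" "w = c \<cdot>\<^sub>v unit_vec n j" by blast
  then have "{i. i < dim_vec w \<and> w $ i \<noteq> 0} = {j}" by (auto split: if_splits)
  then show "wt w = 1" by (simp add: wt_def)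
qed

lemma wt_eq_2_iff:
  fixes w :: "'a::field vec"
  assumes "w \<in> carrier_vec n"
  shows "wt w = 2 \<longleftrightarrow> (\<exists>i<n. \<exists>j<n. \<exists>c d. i \<noteq> j \<and> c \<noteq> 0 \<and> d \<noteq> 0 \<and>
    w = c \<cdot>\<^sub>v unit_vec n i + d \<cdot>\<^sub>v unit_vec n j)"
proof
  assume "wt w = 2"
  then obtain i j where ij: "{i. i < dim_vec w \<and> w $ i \<noteq> 0} = {i, j}" "i \<noteq> j"
    unfolding wt_def by (auto simp: card_2_iff)
  then have n: "i < n" "w $ i \<noteq> 0" "j < n" "w $ j \<noteq> 0"
    and "\<And>k. k < n \<Longrightarrow> k \<noteq> i \<Longrightarrow> k \<noteq> j \<Longrightarrow> w $ k = 0"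
    using assms by auto
  then have "w = w $ i \<cdot>\<^sub>v unit_vec n i + w $ j \<cdot>\<^sub>v unit_vec n j"
    using assms ij(2) by (intro eq_vecI) auto
  with n ij(2) show "\<exists>i<n. \<exists>j<n. \<exists>c d. i \<noteq> j \<and> c \<noteq> 0 \<and> d \<noteq> 0 \<and>
    w = c \<cdot>\<^sub>v unit_vec n i + d \<cdot>\<^sub>v unit_vec n j" by metis
next
  assume "\<exists>i<n. \<exists>j<n. \<exists>c d. i \<noteq> j \<and> c \<noteq> 0 \<and> d \<noteq> 0 \<and>
    w = c \<cdot>\<^sub>v unit_vec n i + d \<cdot>\<^sub>v unit_vec n j"
  then obtain i j c d where "i < n" "j < n" "i \<noteq> j" "c \<noteq> 0" "d \<noteq> 0"
    "w = c \<cdot>\<^sub>v unit_vec n i + d \<cdot>\<^sub>v unit_vec n j" by blast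
  then have "{k. k < dim_vec w \<and> w $ k \<noteq> 0} = {i, j}" by (auto split: if_splits)
  then show "wt w = 2" using \<open>i \<noteq> j\<close> by (simp add: wt_def)
qed

lemma A0_eq_0_iff:
  fixes T :: "'a::{field,finite} mat"
  assumes "T \<in> carrier_mat m n"
  shows "A0 T i = 0 \<longleftrightarrow> (\<forall>w \<in> carrier_vec n. wt w = i \<longrightarrow> T *\<^sub>v w \<noteq> 0\<^sub>v m)"
proof -
  have "CARD('a) > 1"
    by (rule one_less_card_field)
  then show ?thesis
    unfolding A0_def using assms by (auto simp: card_eq_0_iff)
qed

lemma A0_1_eq_0_iff:
  fixes T :: "'a::{field,finite} mat"
  assumes T: "T \<in> carrier_mat m n"
  shows "A0 T 1 = 0 \<longleftrightarrow> (\<forall>j<n. col T j \<noteq> 0\<^sub>v m)"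
proof -
  have "c \<cdot>\<^sub>v v = 0\<^sub>v m \<longleftrightarrow> v = 0\<^sub>v m" if "c \<noteq> 0" "v \<in> carrier_vec m" for c and v :: "'a vec"
    using that by (auto simp: vec_eq_iff)
  then have *: "c \<noteq> 0 \<Longrightarrow> j < n \<Longrightarrow> T *\<^sub>v (c \<cdot>\<^sub>v unit_vec n j) = 0\<^sub>v m \<longleftrightarrow> col T j = 0\<^sub>v m" for c j
    using mult_smult_unit_vec[OF T] T by auto
  show ?thesis
    unfolding A0_eq_0_iff[OF T]
  proof (intro iffI allI impI ballI)
    fix j assume A: "\<forall>w\<in>carrier_vec n. wt w = 1 \<longrightarrow> T *\<^sub>v w \<noteq> 0\<^sub>v m" and j: "j < n"
    let ?w = "1 \<cdot>\<^sub>v unit_vec n j :: 'a vec"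
    have w: "?w \<in> carrier_vec n" by simp
    have "wt ?w = 1" unfolding wt_eq_1_iff[OF w] using j by (metis one_neq_zero)
    with A w have "T *\<^sub>v ?w \<noteq> 0\<^sub>v m" by blast
    with *[of 1 j] j show "col T j \<noteq> 0\<^sub>v m" by simp
  next
    fix w :: "'a vec" assume A: "\<forall>j<n. col T j \<noteq> 0\<^sub>v m" and w: "w \<in> carrier_vec n" "wt w = 1"
    then obtain j c where "j < n" "c \<noteq> 0" "w = c \<cdot>\<^sub>v unit_vec n j"
      using wt_eq_1_iff[OF w(1)] by blast
    with *[of c j] A show "T *\<^sub>v w \<noteq> 0\<^sub>v m" by simp
  qed
qed

lemma A0_2_eq_0_iff:
  fixes T :: "'a::{field,finite} mat"
  assumes T: "T \<in> carrier_mat m n"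
  shows "A0 T 2 = 0 \<longleftrightarrow> (\<forall>i<n. \<forall>j<n. \<forall>c. i \<noteq> j \<and> c \<noteq> 0 \<longrightarrow> col T i \<noteq> c \<cdot>\<^sub>v col T j)"
proof -
  have *: "T *\<^sub>v (c \<cdot>\<^sub>v unit_vec n i + d \<cdot>\<^sub>v unit_vec n j) = c \<cdot>\<^sub>v col T i + d \<cdot>\<^sub>v col T j"
    if "i < n" "j < n" for i j c d
    using that mult_smult_unit_vec[OF T]
    by (subst mult_add_distrib_mat_vec[OF T]) auto
  have eq: "c \<cdot>\<^sub>v v + d \<cdot>\<^sub>v w = 0\<^sub>v m \<longleftrightarrow> v = (- d / c) \<cdot>\<^sub>v w"
    if "c \<noteq> 0" "v \<in> carrier_vec m" "w \<in> carrier_vec m" for c d and v w :: "'a vec"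
    using that by (auto simp: vec_eq_iff field_simps eq_neg_iff_add_eq_0)
  show ?thesis
  proof
    assume A: "A0 T 2 = 0"
    show "\<forall>i<n. \<forall>j<n. \<forall>c. i \<noteq> j \<and> c \<noteq> 0 \<longrightarrow> col T i \<noteq> c \<cdot>\<^sub>v col T j"
    proof (intro allI impI)
      fix i j c assume ij: "i < n" "j < n" and c: "i \<noteq> j \<and> c \<noteq> (0 :: 'a)"
      let ?w = "1 \<cdot>\<^sub>v unit_vec n i + (- c) \<cdot>\<^sub>v unit_vec n j :: 'a vec"
      have w: "?w \<in> carrier_vec n" by simp
      have "wt ?w = 2" unfolding wt_eq_2_iff[OF w] using ij c by (metis neg_equal_0_iff_equal one_neq_zero)
      then have "T *\<^sub>v ?w \<noteq> 0\<^sub>v m" using A w unfolding A0_eq_0_iff[OF T] by blast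
      then show "col T i \<noteq> c \<cdot>\<^sub>v col T j"
        unfolding *[OF ij] using eq[of 1 "col T i" "col T j" "- c"] T ij by auto
    qed
  next
    assume A: "\<forall>i<n. \<forall>j<n. \<forall>c. i \<noteq> j \<and> c \<noteq> 0 \<longrightarrow> col T i \<noteq> c \<cdot>\<^sub>v col T j"
    show "A0 T 2 = 0"
      unfolding A0_eq_0_iff[OF T]
    proof (intro ballI impI)
      fix w :: "'a vec" assume w: "w \<in> carrier_vec n" "wt w = 2"
      then obtain i j c d where ij: "i < n" "j < n" "i \<noteq> j" "c \<noteq> 0" "d \<noteq> 0"
        "w = c \<cdot>\<^sub>v unit_vec n i + d \<cdot>\<^sub>v unit_vec n j" using wt_eq_2_iff[OF w(1)] by blast
      then have "col T i \<noteq> (- d / c) \<cdot>\<^sub>v col T j" using A by simp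
      then show "T *\<^sub>v w \<noteq> 0\<^sub>v m"
        unfolding ij(6) *[OF ij(1,2)] using eq[OF ij(4), of "col T i" "col T j" d] T ij by auto
    qed
  qed
qed

section \<open>Words that involve one block effect\<close>

lemma enum_list_props:
  assumes "finite S"
  shows "distinct (enum_list S)" and "set (enum_list S) = S"
  using someI_ex[of "\<lambda>xs. distinct xs \<and> set xs = S"] finite_distinct_list[OF assms]
  unfolding enum_list_def by auto

lemma normalized_vecs_subset: "normalized_vecs p \<subseteq> carrier_vec p"
  by (auto simp: normalized_vecs_def)

lemma smult_normalized_cancel:
  assumes l: "l \<in> normalized_vecs p" and l': "l' \<in> normalized_vecs p"
    and c: "c \<noteq> 0" and c': "c' \<noteq> 0" and eq: "c \<cdot>\<^sub>v l = c' \<cdot>\<^sub>v l'"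
  shows "c = c'" and "l = l'"
proof -
  obtain i where i: "i < p" "l $ i = 1" "\<And>j. j < i \<Longrightarrow> l $ j = 0"
    using l by (auto simp: normalized_vecs_def)
  obtain i' where i': "i' < p" "l' $ i' = 1" "\<And>j. j < i' \<Longrightarrow> l' $ j = 0"
    using l' by (auto simp: normalized_vecs_def)
  have d: "dim_vec l = p" "dim_vec l' = p" using l l' by (auto simp: normalized_vecs_def)
  have e: "c * l $ j = c' * l' $ j" if "j < p" for j
    using eq that d by (metis index_smult_vec(1))
  have "i = i'"
    using e[of i] e[of i'] i i' c c' by (metis linorder_neqE_nat mult.right_neutral mult_zero_right)
  then show cc: "c = c'" using e[of i] i i' by simp
  show "l = l'"
    using e c d unfolding cc by (intro eq_vecI) auto
qed

lemma normalize_vec: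
  assumes y: "y \<in> carrier_vec p" and y0: "y \<noteq> 0\<^sub>v p"
  obtains c l where "c \<noteq> 0" and "l \<in> normalized_vecs p" and "y = c \<cdot>\<^sub>v l"
proof -
  have "\<exists>i. i < p \<and> y $ i \<noteq> 0"
    using y y0 by (auto simp: vec_eq_iff)
  then obtain i where i: "i < p" "y $ i \<noteq> 0" and least: "\<And>j. j < i \<Longrightarrow> \<not> (j < p \<and> y $ j \<noteq> 0)"
    using exists_least_iff[of "\<lambda>i. i < p \<and> y $ i \<noteq> 0"] by blast
  show ?thesis
  proof
    show "y $ i \<noteq> 0" by fact
    show "inverse (y $ i) \<cdot>\<^sub>v y \<in> normalized_vecs p"
      unfolding normalized_vecs_def
    proof (intro CollectI conjI exI[of _ i] allI impI)
      show "inverse (y $ i) \<cdot>\<^sub>v y \<in> carrier_vec p" using y by simp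
      show "(inverse (y $ i) \<cdot>\<^sub>v y) $ i = 1" using y i by simp
      show "(inverse (y $ i) \<cdot>\<^sub>v y) $ j = 0" if "j < i" for j
        using y i least[OF that] that by simp
    qed (rule i)
    show "y = y $ i \<cdot>\<^sub>v (inverse (y $ i) \<cdot>\<^sub>v y)"
      using i by (intro eq_vecI) auto
  qed
qed

lemma block_effects_carrier:
  assumes "B \<in> carrier_mat m p"
  shows "block_effects B \<in> carrier_mat m (dim_col (block_effects B))"
  using assms by (intro carrier_matI) (simp_all add: block_effects_def)

text \<open>
  Each nonzero vector is in a unique way a scalar times a normalized one. Hence the nonzero
  multiples of the columns of the block effect matrix run through the nonzero vectors of the range of \<open>B\<close>,
  each exactly once.
\<close>

lemma ex1_block_effect:
  fixes B :: "'a::{field,finite} mat"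
  assumes B: "B \<in> carrier_mat m p" and inj: "inj_on (\<lambda>v. B *\<^sub>v v) (carrier_vec p)"
  shows "x \<in> mat_range B \<Longrightarrow> x \<noteq> 0\<^sub>v m \<Longrightarrow>
      \<exists>!w. w \<in> carrier_vec (dim_col (block_effects B)) \<and> wt w = 1 \<and> block_effects B *\<^sub>v w = x"
    and "\<And>w. w \<in> carrier_vec (dim_col (block_effects B)) \<Longrightarrow> wt w = 1 \<Longrightarrow>
      block_effects B *\<^sub>v w \<in> mat_range B - {0\<^sub>v m}"
proof -
  let ?L = "enum_list (normalized_vecs p :: 'a vec set)" and ?F = "block_effects B"
  have fin: "finite (normalized_vecs p :: 'a vec set)"
    by (rule finite_subset[OF normalized_vecs_subset]) simp
  note L = enum_list_props[OF fin]
  let ?N = "dim_col ?F"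
  have N: "?N = length ?L" using B by (simp add: block_effects_def)
  have F: "?F \<in> carrier_mat m ?N" using block_effects_carrier[OF B] .
  have Lj: "?L ! j \<in> normalized_vecs p" "?L ! j \<in> carrier_vec p" if "j < ?N" for j
    using that L(2) N normalized_vecs_subset[of p] nth_mem[of j ?L] by auto
  have col: "col ?F j = B *\<^sub>v ?L ! j" if "j < ?N" for j
    using that N B Lj[OF that] unfolding block_effects_def by (subst col_mat_of_cols) auto
  have Fw: "?F *\<^sub>v (c \<cdot>\<^sub>v unit_vec ?N j) = B *\<^sub>v (c \<cdot>\<^sub>v ?L ! j)" if "j < ?N" for c j
    using mult_smult_unit_vec[OF F that, of c] col[OF that] mult_mat_vec[OF B Lj(2)[OF that], of c] by simp
  have B0: "B *\<^sub>v 0\<^sub>v p = 0\<^sub>v m" using B by (intro eq_vecI) auto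
  have ne0: "c \<cdot>\<^sub>v l \<noteq> 0\<^sub>v p" if c: "c \<noteq> 0" and l: "l \<in> normalized_vecs p" for c and l :: "'a vec"
  proof -
    obtain i where "i < p" "l $ i = 1" "l \<in> carrier_vec p" using l by (auto simp: normalized_vecs_def)
    then have "(c \<cdot>\<^sub>v l) $ i \<noteq> 0\<^sub>v p $ i" using c by simp
    then show ?thesis by metis
  qed
  show "?F *\<^sub>v w \<in> mat_range B - {0\<^sub>v m}" if w: "w \<in> carrier_vec ?N" "wt w = 1" for w
  proof -
    obtain j c where j: "j < ?N" "c \<noteq> 0" "w = c \<cdot>\<^sub>v unit_vec ?N j"
      using w wt_eq_1_iff by blast
    have cl: "c \<cdot>\<^sub>v ?L ! j \<in> carrier_vec p" using Lj j by simp
    have "B *\<^sub>v (c \<cdot>\<^sub>v ?L ! j) \<noteq> B *\<^sub>v 0\<^sub>v p"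
      using inj_onD[OF inj _ cl zero_carrier_vec] ne0[OF j(2) Lj(1)[OF j(1)]] by blast
    then show ?thesis
      unfolding j(3) Fw[OF j(1)] B0 using cl B by (auto simp: mat_range_def)
  qed
  show "\<exists>!w. w \<in> carrier_vec ?N \<and> wt w = 1 \<and> ?F *\<^sub>v w = x" if x: "x \<in> mat_range B" "x \<noteq> 0\<^sub>v m"
  proof -
    obtain y where y: "y \<in> carrier_vec p" "x = B *\<^sub>v y"
      using x B by (auto simp: mat_range_def)
    have "y \<noteq> 0\<^sub>v p" using x y B0 by auto
    then obtain c l where cl: "c \<noteq> 0" "l \<in> normalized_vecs p" "y = c \<cdot>\<^sub>v l"
      using normalize_vec[OF y(1)] by blast
    obtain j where j: "j < ?N" "?L ! j = l"
      using cl(2) L(2) N by (metis in_set_conv_nth)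
    let ?w = "c \<cdot>\<^sub>v unit_vec ?N j :: 'a vec"
    show ?thesis
    proof (rule ex1I[of _ ?w])
      show "?w \<in> carrier_vec ?N \<and> wt ?w = 1 \<and> ?F *\<^sub>v ?w = x"
        using wt_eq_1_iff[of ?w ?N] j cl Fw[OF j(1), of c] y by auto
    next
      fix w assume w: "w \<in> carrier_vec ?N \<and> wt w = 1 \<and> ?F *\<^sub>v w = x"
      then obtain j' c' where j': "j' < ?N" "c' \<noteq> 0" "w = c' \<cdot>\<^sub>v unit_vec ?N j'"
        using wt_eq_1_iff[of w ?N] by blast
      have "B *\<^sub>v (c' \<cdot>\<^sub>v ?L ! j') = B *\<^sub>v (c \<cdot>\<^sub>v ?L ! j)"
        using w j'(3) Fw[OF j'(1), of c'] y cl j by simp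
      then have "c' \<cdot>\<^sub>v ?L ! j' = c \<cdot>\<^sub>v ?L ! j"
        using inj Lj(2)[OF j(1)] Lj(2)[OF j'(1)] by (auto simp: inj_on_def)
      then have "c' = c" "?L ! j' = ?L ! j"
        using smult_normalized_cancel[OF Lj(1)[OF j'(1)] Lj(1)[OF j(1)] j'(2) cl(1)] by auto
      then show "w = ?w"
        using j' j L(1) N nth_eq_iff_index_eq by metis
    qed
  qed
qed

text \<open>
  The component \<open>w2\<close> of weight one is determined by \<open>w1\<close>, and it exists precisely if \<open>T w1\<close> is a
  nonzero vector in the range of \<open>B\<close>.
\<close>

lemma card_one_block_effect:
  fixes B :: "'a::{field,finite} mat"
  assumes T: "T \<in> carrier_mat m n"
    and B: "B \<in> carrier_mat m p" and inj: "inj_on (\<lambda>v. B *\<^sub>v v) (carrier_vec p)"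
  shows "card {(w1, w2). w1 \<in> carrier_vec n \<and> w2 \<in> carrier_vec (dim_col (block_effects B)) \<and>
      T *\<^sub>v w1 + block_effects B *\<^sub>v w2 = 0\<^sub>v m \<and> wt w1 = i \<and> wt w2 = 1}
    = card {w \<in> carrier_vec n. T *\<^sub>v w \<in> mat_range B - {0\<^sub>v m} \<and> wt w = i}"
proof -
  let ?F = "block_effects B"
  define N where "N = dim_col (block_effects B)"
  let ?P = "{(w1, w2). w1 \<in> carrier_vec n \<and> w2 \<in> carrier_vec N \<and>
      T *\<^sub>v w1 + ?F *\<^sub>v w2 = 0\<^sub>v m \<and> wt w1 = i \<and> wt w2 = 1}"
  let ?S = "{w \<in> carrier_vec n. T *\<^sub>v w \<in> mat_range B - {0\<^sub>v m} \<and> wt w = i}"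
  have F: "?F \<in> carrier_mat m N" using block_effects_carrier[OF B] unfolding N_def .
  note effect = ex1_block_effect[OF B inj, folded N_def]
  have eq: "u + v = 0\<^sub>v m \<longleftrightarrow> v = (- 1) \<cdot>\<^sub>v u" "u + v = 0\<^sub>v m \<longleftrightarrow> u = (- 1) \<cdot>\<^sub>v v"
    if "u \<in> carrier_vec m" "v \<in> carrier_vec m" for u v :: "'a vec"
    using that by (auto simp: vec_eq_iff eq_neg_iff_add_eq_0 add.commute)
  have neg: "(- 1) \<cdot>\<^sub>v x \<in> mat_range B - {0\<^sub>v m}" if x: "x \<in> mat_range B - {0\<^sub>v m}" for x
  proof -
    obtain y where y: "y \<in> carrier_vec p" "x = B *\<^sub>v y"
      using x B by (auto simp: mat_range_def)
    have "(- 1) \<cdot>\<^sub>v x = B *\<^sub>v ((- 1) \<cdot>\<^sub>v y)"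
      using mult_mat_vec[OF B y(1), of "- 1"] y by simp
    moreover have "(- 1) \<cdot>\<^sub>v x \<noteq> 0\<^sub>v m"
      using x y B by (auto simp: vec_eq_iff)
    ultimately show ?thesis using y B by (auto simp: mat_range_def)
  qed
  have "bij_betw fst ?P ?S"
    unfolding bij_betw_def
  proof
    show "inj_on fst ?P"
    proof (rule inj_onI)
      fix x y assume xy: "x \<in> ?P" "y \<in> ?P" "fst x = fst y"
      then obtain w v v' where wv: "x = (w, v)" "y = (w, v')"
        by (metis prod.collapse)
      have w: "w \<in> carrier_vec n" and v: "v \<in> carrier_vec N" "v' \<in> carrier_vec N"
        "wt v = 1" "wt v' = 1"
        and e: "T *\<^sub>v w + ?F *\<^sub>v v = 0\<^sub>v m" "T *\<^sub>v w + ?F *\<^sub>v v' = 0\<^sub>v m"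
        using xy unfolding wv by simp_all
      have "?F *\<^sub>v v = ?F *\<^sub>v v'"
        using e eq(1)[of "T *\<^sub>v w"] T F w v by (metis mult_mat_vec_carrier)
      moreover have "?F *\<^sub>v v \<in> mat_range B" "?F *\<^sub>v v \<noteq> 0\<^sub>v m"
        using effect(2)[OF v(1)] v by auto
      ultimately have "v = v'"
        using effect(1) v by metis
      then show "x = y" by (simp add: wv)
    qed
    show "fst ` ?P = ?S"
    proof
      show "fst ` ?P \<subseteq> ?S"
      proof clarify
        fix w v
        assume w: "w \<in> carrier_vec n" and v: "v \<in> carrier_vec N" "wt v = 1"
          and e: "T *\<^sub>v w + ?F *\<^sub>v v = 0\<^sub>v m"
        have "T *\<^sub>v w = (- 1) \<cdot>\<^sub>v (?F *\<^sub>v v)"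
          using eq(2)[of "T *\<^sub>v w"] T F w v e by (metis mult_mat_vec_carrier)
        then have "T *\<^sub>v w \<in> mat_range B - {0\<^sub>v m}"
          using neg effect(2)[OF v] by metis
        then show "fst (w, v) \<in> carrier_vec n \<and> T *\<^sub>v fst (w, v) \<in> mat_range B - {0\<^sub>v m} \<and> wt (fst (w, v)) = wt w"
          using w by simp
      qed
      show "?S \<subseteq> fst ` ?P"
      proof
        fix w assume w: "w \<in> ?S"
        obtain v where v: "v \<in> carrier_vec N" "wt v = 1" "?F *\<^sub>v v = (- 1) \<cdot>\<^sub>v (T *\<^sub>v w)"
          using effect(1) neg[of "T *\<^sub>v w"] w by (metis (no_types, lifting) Diff_iff insertCI mem_Collect_eq)
        have "T *\<^sub>v w + ?F *\<^sub>v v = 0\<^sub>v m"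
          using eq(1)[of "T *\<^sub>v w" "?F *\<^sub>v v"] T F w v by (metis (no_types, lifting) mem_Collect_eq mult_mat_vec_carrier)
        then have "(w, v) \<in> ?P" using w v by simp
        then show "w \<in> fst ` ?P" by force
      qed
    qed
  qed
  then show ?thesis
    unfolding N_def by (rule bij_betw_same_card)
qed

text \<open>
  The common value of \<open>A0 T i + A1 T B i\<close> for all designs with \<open>n\<close> columns, none of which lies in the
  hyperplane of block effects; the denominator is the one of the wordlength patterns.
\<close>

definition zero_sum_count :: "'a::{field,finite} itself \<Rightarrow> nat \<Rightarrow> nat \<Rightarrow> real" where
  "zero_sum_count _ n i =
     real (card {w \<in> carrier_vec n. (\<Sum>j<n. w $ j) = (0 :: 'a) \<and> wt w = i}) / (real CARD('a) - 1)"

text \<open>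
  The key identity. Let the linear form \<open>a\<close> define the range of \<open>B\<close>. Then \<open>T w\<close> lies in this range
  iff \<open>\<Sum>j. (a \<bullet> col T j) * w $ j = 0\<close>. If all the coefficients are nonzero, rescaling makes them equal
  to \<open>1\<close>, and the number of such \<open>w\<close> of weight \<open>i\<close> no longer depends on \<open>T\<close> or \<open>B\<close>. Those with
  \<open>T w \<noteq> 0\<close> are counted by \<open>A1\<close>, those with \<open>T w = 0\<close> by \<open>A0\<close>.
\<close>

lemma A1_eq:
  fixes T B :: "'a::{field,finite} mat"
  assumes T: "T \<in> carrier_mat m n"
    and B: "B \<in> carrier_mat m p" and inj: "inj_on (\<lambda>v. B *\<^sub>v v) (carrier_vec p)"
    and a: "a \<in> carrier_vec m"
    and range: "\<And>x. x \<in> carrier_vec m \<Longrightarrow> x \<in> mat_range B \<longleftrightarrow> a \<bullet> x = 0"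
    and ne: "\<And>j. j < n \<Longrightarrow> a \<bullet> col T j \<noteq> 0"
  shows "A1 T B i = zero_sum_count TYPE('a) n i - A0 T i"
proof -
  let ?q = "\<lambda>j. a \<bullet> col T j"
  let ?Z = "{w \<in> carrier_vec n. T *\<^sub>v w = 0\<^sub>v m \<and> wt w = i}"
  let ?S = "{w \<in> carrier_vec n. T *\<^sub>v w \<in> mat_range B - {0\<^sub>v m} \<and> wt w = i}"
  let ?U = "{w \<in> carrier_vec n. T *\<^sub>v w \<in> mat_range B \<and> wt w = i}"
  have "a \<bullet> (T *\<^sub>v w) = (\<Sum>j<n. scale_vec ?q w $ j)" if w: "w \<in> carrier_vec n" for w
  proof -
    have "a \<bullet> (T *\<^sub>v w) = (transpose_mat T *\<^sub>v a) \<bullet> w"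
      using transpose_vec_mult_scalar[OF T w a] by simp
    also have "\<dots> = (\<Sum>j<n. (col T j \<bullet> a) * w $ j)"
      using T w by (simp add: scalar_prod_def[of "transpose_mat T *\<^sub>v a"] atLeast0LessThan)
    also have "\<dots> = (\<Sum>j<n. scale_vec ?q w $ j)"
      using w T a by (intro sum.cong) (auto simp: scale_vec_def comm_scalar_prod[of "col T _" m])
    finally show ?thesis .
  qed
  then have "?U = {w \<in> carrier_vec n. (\<Sum>j<n. scale_vec ?q w $ j) = 0 \<and> wt w = i}"
    using range T by (auto simp: mult_mat_vec_carrier)
  then have U: "card ?U = card {w \<in> carrier_vec n. (\<Sum>j<n. w $ j) = (0 :: 'a) \<and> wt w = i}"
    using card_scale_vec[of n ?q "\<lambda>w. (\<Sum>j<n. w $ j) = 0" i] ne by simp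
  have "0\<^sub>v m \<in> mat_range B"
    using range[of "0\<^sub>v m"] a by simp
  then have "?U = ?S \<union> ?Z" and "?S \<inter> ?Z = {}" by auto
  then have "card ?U = card ?S + card ?Z"
    by (simp add: card_Un_disjoint)
  moreover have "A1 T B i = real (card ?S) / (real CARD('a) - 1)"
    unfolding A1_def using card_one_block_effect[OF T B inj, of i] T by simp
  ultimately show ?thesis
    using U T by (simp add: zero_sum_count_def A0_def field_simps diff_divide_distrib[symmetric])
qed

lemma A1_1_eq_0_iff:
  fixes T B :: "'a::{field,finite} mat"
  assumes T: "T \<in> carrier_mat m n"
    and B: "B \<in> carrier_mat m p" and inj: "inj_on (\<lambda>v. B *\<^sub>v v) (carrier_vec p)"
    and col: "\<And>j. j < n \<Longrightarrow> col T j \<noteq> 0\<^sub>v m"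
  shows "A1 T B 1 = 0 \<longleftrightarrow> (\<forall>j<n. col T j \<notin> mat_range B)"
proof -
  let ?S = "{w \<in> carrier_vec n. T *\<^sub>v w \<in> mat_range B - {0\<^sub>v m} \<and> wt w = 1}"
  have "CARD('a) > 1"
    by (rule one_less_card_field)
  moreover have "A1 T B 1 = real (card ?S) / (real CARD('a) - 1)"
    unfolding A1_def using card_one_block_effect[OF T B inj, of 1] T by simp
  moreover have "finite ?S" by simp
  ultimately have "A1 T B 1 = 0 \<longleftrightarrow> ?S = {}"
    by (simp add: card_eq_0_iff)
  also have "\<dots> \<longleftrightarrow> (\<forall>j<n. col T j \<notin> mat_range B)"
  proof
    assume S: "?S = {}"
    show "\<forall>j<n. col T j \<notin> mat_range B"
    proof (intro allI impI)
      fix j assume j: "j < n"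
      let ?w = "1 \<cdot>\<^sub>v unit_vec n j :: 'a vec"
      have w: "?w \<in> carrier_vec n" by simp
      have "wt ?w = 1" unfolding wt_eq_1_iff[OF w] using j by (metis one_neq_zero)
      with S w have "T *\<^sub>v ?w \<notin> mat_range B - {0\<^sub>v m}" by blast
      moreover have "T *\<^sub>v ?w = col T j" using mult_smult_unit_vec[OF T j, of 1] by simp
      ultimately show "col T j \<notin> mat_range B" using col[OF j] by auto
    qed
  next
    assume A: "\<forall>j<n. col T j \<notin> mat_range B"
    have "w \<notin> ?S" for w
    proof
      assume w: "w \<in> ?S"
      then obtain j c where j: "j < n" "c \<noteq> 0" "w = c \<cdot>\<^sub>v unit_vec n j"
        using wt_eq_1_iff[of w n] by blast
      obtain y where y: "y \<in> carrier_vec p" "T *\<^sub>v w = B *\<^sub>v y"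
        using w B by (auto simp: mat_range_def)
      have "col T j = inverse c \<cdot>\<^sub>v (T *\<^sub>v w)"
        unfolding j(3) mult_smult_unit_vec[OF T j(1)] using j(2) by (intro eq_vecI) auto
      also have "\<dots> = B *\<^sub>v (inverse c \<cdot>\<^sub>v y)"
        using y mult_mat_vec[OF B y(1), of "inverse c"] by simp
      finally have "col T j \<in> mat_range B"
        unfolding mat_range_def using y B by auto
      with A j show False by blast
    qed
    then show "?S = {}" by blast
  qed
  finally show ?thesis .
qed

section \<open>RME designs and projection designs\<close>

lemma smult_mem_mat_range:
  fixes B :: "'a::field mat"
  assumes "B \<in> carrier_mat m p" "x \<in> mat_range B"
  shows "c \<cdot>\<^sub>v x \<in> mat_range B"
proof -
  obtain y where y: "y \<in> carrier_vec p" "x = B *\<^sub>v y"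
    using assms by (auto simp: mat_range_def)
  then have "c \<cdot>\<^sub>v x = B *\<^sub>v (c \<cdot>\<^sub>v y)"
    using mult_mat_vec[OF assms(1) y(1), of c] by simp
  then show ?thesis using y assms by (auto simp: mat_range_def)
qed

lemma zero_mem_mat_range:
  fixes B :: "'a::field mat"
  assumes "B \<in> carrier_mat m p"
  shows "0\<^sub>v m \<in> mat_range B"
proof -
  have "B *\<^sub>v 0\<^sub>v p = 0\<^sub>v m" using assms by (intro eq_vecI) auto
  then show ?thesis using assms unfolding mat_range_def by (intro image_eqI[of _ _ "0\<^sub>v p"]) auto
qed

text \<open>
  A word of weight one is a single column, and a word of weight two expresses that two columns are
  proportional. Hence the columns of an RME design are distinct projective points outside of the
  subspace of block effects.
\<close>

lemma RME_designs_iff: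
  fixes T B :: "'a::{field,finite} mat"
  shows "(T, B) \<in> RME_designs m n p \<longleftrightarrow>
    T \<in> regular_generators m n \<and> B \<in> carrier_mat m p \<and> vec_space.rank m B = p \<and>
    (\<forall>j<n. col T j \<notin> mat_range B) \<and>
    (\<forall>i<n. \<forall>j<n. \<forall>c. i \<noteq> j \<and> c \<noteq> 0 \<longrightarrow> col T i \<noteq> c \<cdot>\<^sub>v col T j)"
proof (cases "T \<in> regular_generators m n \<and> B \<in> carrier_mat m p \<and> vec_space.rank m B = p")
  case True
  then have T: "T \<in> carrier_mat m n" and B: "B \<in> carrier_mat m p"
    and inj: "inj_on (\<lambda>v. B *\<^sub>v v) (carrier_vec p)"
    using full_column_rank_imp_inj by (auto simp: regular_generators_def)
  have 0: "0\<^sub>v m \<in> mat_range B" using zero_mem_mat_range[OF B] .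
  have "(T, B) \<in> RME_designs m n p \<longleftrightarrow> A0 T 1 = 0 \<and> A0 T 2 = 0 \<and> A1 T B 1 = 0"
    using True by (simp add: RME_designs_def blocked_designs_def)
  also have "\<dots> \<longleftrightarrow> (\<forall>j<n. col T j \<notin> mat_range B) \<and> A0 T 2 = 0"
    using A1_1_eq_0_iff[OF T B inj] A0_1_eq_0_iff[OF T] 0 by metis
  finally show ?thesis
    using True A0_2_eq_0_iff[OF T] by simp
next
  case False
  then show ?thesis by (auto simp: RME_designs_def blocked_designs_def)
qed

text \<open>
  For \<open>p = m - 1\<close> the block effects fill a hyperplane, so that a single linear form decides which
  vectors are confounded with blocks.
\<close>

lemma A1_eq_of_RME:
  fixes T B :: "'a::{field,finite} mat"
  assumes "(T, B) \<in> RME_designs (Suc d) n d"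
  shows "A1 T B i = zero_sum_count TYPE('a) n i - A0 T i"
proof -
  have T: "T \<in> carrier_mat (Suc d) n" and B: "B \<in> carrier_mat (Suc d) d" and r: "vec_space.rank (Suc d) B = d"
    and col: "\<And>j. j < n \<Longrightarrow> col T j \<notin> mat_range B"
    using assms by (auto simp: RME_designs_iff regular_generators_def)
  obtain P Q where Q: "Q \<in> carrier_mat (Suc d) (Suc d)"
    and range: "\<And>x. x \<in> carrier_vec (Suc d) \<Longrightarrow> x \<in> mat_range B \<longleftrightarrow> (Q *\<^sub>v x) $ d = 0"
    by (rule hyperplane_coordinates[OF B r]) (rule that)
  let ?a = "row Q d"
  have range': "x \<in> mat_range B \<longleftrightarrow> ?a \<bullet> x = 0" if "x \<in> carrier_vec (Suc d)" for x
    using range[OF that] Q by simp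
  show ?thesis
  proof (rule A1_eq[OF T B full_column_rank_imp_inj[OF B r] _ range'])
    show "?a \<in> carrier_vec (Suc d)" using Q by (intro carrier_vecI) simp
    show "?a \<bullet> col T j \<noteq> 0" if "j < n" for j
      using col[OF that] range'[of "col T j"] T that by simp
  qed
qed

lemma col_code_matrix:
  fixes T :: "'a::{field,finite} mat"
  assumes "j < dim_col T"
  shows "col (code_matrix T) j = vec (length (enum_list (carrier_vec (dim_row T) :: 'a vec set)))
    (\<lambda>r. col T j \<bullet> enum_list (carrier_vec (dim_row T)) ! r)"
  using assms
  by (intro eq_vecI) (auto simp: code_matrix_def vec_times_mat_def mat_of_rows_def)

lemma code_matrix_dim [simp]:
  fixes T :: "'a::{field,finite} mat"
  shows "dim_col (code_matrix T) = dim_col T"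
    and "dim_row (code_matrix T) = length (enum_list (carrier_vec (dim_row T) :: 'a vec set))"
  by (auto simp: code_matrix_def)

text \<open>
  The entries of a column of the code are the scalar products of the generating column with all
  vectors, among them the unit vectors, which recover its entries.
\<close>

lemma col_code_matrix_eq_iff:
  fixes T M :: "'a::{field,finite} mat"
  assumes T: "dim_row T = m" "j < dim_col T" and M: "dim_row M = m" "k < dim_col M"
  shows "col (code_matrix T) j = col (code_matrix M) k \<longleftrightarrow> col T j = col M k"
proof
  let ?us = "enum_list (carrier_vec m :: 'a vec set)"
  assume eq: "col (code_matrix T) j = col (code_matrix M) k"
  have "col T j \<bullet> u = col M k \<bullet> u" if u: "u \<in> carrier_vec m" for u
  proof -
    obtain r where r: "r < length ?us" "?us ! r = u"
      using u enum_list_props(2)[of "carrier_vec m :: 'a vec set"] by (metis finite_carrier_vec in_set_conv_nth)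
    show ?thesis
      using arg_cong[OF eq, of "\<lambda>v. v $ r"] r T M by (simp add: col_code_matrix)
  qed
  then have "col T j $ i = col M k $ i" if "i < m" for i
    using that by (metis scalar_prod_right_unit unit_vec_carrier)
  then show "col T j = col M k"
    using T M by (intro eq_vecI) auto
qed (use T M in \<open>simp add: col_code_matrix\<close>)

lemma projection_designs_iff:
  fixes T M :: "'a::{field,finite} mat"
  assumes M: "dim_row M = m"
  shows "T \<in> projection_designs m n M \<longleftrightarrow> T \<in> regular_generators m n \<and>
    (\<exists>js. length js = n \<and> distinct js \<and> set js \<subseteq> {..<dim_col M} \<and> (\<forall>i<n. col T i = col M (js ! i)))"
proof (cases "T \<in> regular_generators m n")
  case True
  then have T: "dim_row T = m" "dim_col T = n" by (auto simp: regular_generators_def)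
  have "code_matrix T = mat_of_cols (dim_row (code_matrix M)) (map (col (code_matrix M)) js) \<longleftrightarrow>
      (\<forall>i<n. col T i = col M (js ! i))" (is "_ = ?R \<longleftrightarrow> _")
    if js: "length js = n" "set js \<subseteq> {..<dim_col M}" for js
  proof -
    have jsi: "js ! i < dim_col M" if "i < n" for i
      using js that nth_mem by fastforce
    have colR: "col ?R i = col (code_matrix M) (js ! i)" if "i < n" for i
    proof -
      have "map (col (code_matrix M)) js ! i = col (code_matrix M) (js ! i)"
        using that js(1) by simp
      moreover have "col (code_matrix M) (js ! i) \<in> carrier_vec (dim_row (code_matrix M))"
        by (rule col_dim)
      ultimately show ?thesis
        using col_mat_of_cols[of i "map (col (code_matrix M)) js" "dim_row (code_matrix M)"] that js(1)
        by (metis length_map)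
    qed
    have "code_matrix T = ?R \<longleftrightarrow> (\<forall>i<n. col (code_matrix T) i = col ?R i)"
      using T M js by (auto intro!: mat_col_eqI)
    also have "\<dots> \<longleftrightarrow> (\<forall>i<n. col (code_matrix T) i = col (code_matrix M) (js ! i))"
      using colR by simp
    also have "\<dots> \<longleftrightarrow> (\<forall>i<n. col T i = col M (js ! i))"
      using col_code_matrix_eq_iff[of T m _ M] T M jsi by simp
    finally show ?thesis .
  qed
  then show ?thesis
    using True by (auto simp: projection_designs_def is_projection_def)
next
  case False
  then show ?thesis by (simp add: projection_designs_def)
qed

lemma proj_point_eq_iff:
  fixes u v :: "'a::field vec"
  shows "proj_point u = proj_point v \<longleftrightarrow> (\<exists>c. c \<noteq> 0 \<and> u = c \<cdot>\<^sub>v v)"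
proof
  assume eq: "proj_point u = proj_point v"
  have "1 \<cdot>\<^sub>v u \<in> proj_point u" "1 \<cdot>\<^sub>v v \<in> proj_point v" unfolding proj_point_def by blast+
  then have "u \<in> proj_point v" "v \<in> proj_point u" using eq by auto
  then obtain c d where cd: "u = c \<cdot>\<^sub>v v" "v = d \<cdot>\<^sub>v u" by (auto simp: proj_point_def)
  show "\<exists>c. c \<noteq> 0 \<and> u = c \<cdot>\<^sub>v v"
  proof (cases "c = 0")
    case True
    have dim: "dim_vec u = dim_vec v" using cd(1) by simp
    have u0: "u $ i = 0" if "i < dim_vec v" for i using cd(1) True that by simp
    have "v $ i = 0" if "i < dim_vec v" for i
      using u0[OF that] arg_cong[OF cd(2), of "\<lambda>x. x $ i"] that dim by simp
    then have "u = 1 \<cdot>\<^sub>v v" using u0 dim by (intro eq_vecI) auto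
    then show ?thesis by (metis one_neq_zero)
  qed (use cd in blast)
next
  assume "\<exists>c. c \<noteq> 0 \<and> u = c \<cdot>\<^sub>v v"
  then obtain c where c: "c \<noteq> 0" "u = c \<cdot>\<^sub>v v" by blast
  have "e \<cdot>\<^sub>v u = (e * c) \<cdot>\<^sub>v v" "e \<cdot>\<^sub>v v = (e / c) \<cdot>\<^sub>v u" for e
    using c by (auto intro!: eq_vecI)
  then show "proj_point u = proj_point v"
    unfolding proj_point_def by blast
qed

text \<open>
  A subspace contains a nonzero vector iff it contains its projective point. Hence representatives of
  the points that are not contained in the subspace are pairwise non-proportional vectors outside of
  it, and there is one proportional to each such vector.
\<close>

lemma hyperplane_complement_columns:
  fixes M B :: "'a::{field,finite} mat"
  assumes B: "B \<in> carrier_mat m p"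
    and rep: "represents_points m M (proj_points m - {P \<in> proj_points m. P \<subseteq> mat_range B})"
  shows "k < dim_col M \<Longrightarrow> col M k \<notin> mat_range B"
    and "k < dim_col M \<Longrightarrow> l < dim_col M \<Longrightarrow> c \<noteq> 0 \<Longrightarrow> col M k = c \<cdot>\<^sub>v col M l \<Longrightarrow> k = l"
    and "v \<in> carrier_vec m \<Longrightarrow> v \<notin> mat_range B \<Longrightarrow> \<exists>k<dim_col M. \<exists>c. c \<noteq> 0 \<and> col M k = c \<cdot>\<^sub>v v"
proof -
  let ?C = "proj_points m - {P \<in> proj_points m. P \<subseteq> mat_range B}"
  have M: "dim_row M = m" and bij: "bij_betw (\<lambda>j. proj_point (col M j)) {..<dim_col M} ?C"
    using rep by (auto simp: represents_points_def)
  have sub: "proj_point v \<subseteq> mat_range B" if "v \<in> mat_range B" for v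
    using smult_mem_mat_range[OF B that] by (auto simp: proj_point_def)
  show "col M k \<notin> mat_range B" if "k < dim_col M"
    using bij_betwE[OF bij] sub that by blast
  show "k = l" if "k < dim_col M" "l < dim_col M" "c \<noteq> 0" "col M k = c \<cdot>\<^sub>v col M l"
    using bij_betw_imp_inj_on[OF bij] that proj_point_eq_iff[of "col M k" "col M l"]
    by (auto simp: inj_on_def)
  show "\<exists>k<dim_col M. \<exists>c. c \<noteq> 0 \<and> col M k = c \<cdot>\<^sub>v v" if v: "v \<in> carrier_vec m" "v \<notin> mat_range B"
  proof -
    have "1 \<cdot>\<^sub>v v \<in> proj_point v" unfolding proj_point_def by blast
    then have "\<not> proj_point v \<subseteq> mat_range B" using v by auto
    moreover have "proj_point v \<in> proj_points m"
      unfolding proj_points_def using v zero_mem_mat_range[OF B] by blast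
    ultimately have "proj_point v \<in> ?C" by blast
    then obtain k where "k < dim_col M" "proj_point (col M k) = proj_point v"
      using bij_betw_imp_surj_on[OF bij] by (metis (no_types, lifting) image_iff lessThan_iff)
    then show ?thesis unfolding proj_point_eq_iff by blast
  qed
qed

lemma projection_design_is_RME:
  fixes M B T :: "'a::{field,finite} mat"
  assumes B: "B \<in> carrier_mat m p" and r: "vec_space.rank m B = p"
    and rep: "represents_points m M (proj_points m - {P \<in> proj_points m. P \<subseteq> mat_range B})"
    and T: "T \<in> projection_designs m n M"
  shows "(T, B) \<in> RME_designs m n p"
proof -
  note compl = hyperplane_complement_columns[OF B rep]
  have "dim_row M = m" using rep by (simp add: represents_points_def)
  then obtain js where T': "T \<in> regular_generators m n" and js: "length js = n" "distinct js"
    "set js \<subseteq> {..<dim_col M}" and col: "\<And>i. i < n \<Longrightarrow> col T i = col M (js ! i)"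
    using T by (auto simp: projection_designs_iff)
  have jsi: "js ! i < dim_col M" if "i < n" for i
    using js that nth_mem by fastforce
  show ?thesis
    unfolding RME_designs_iff
  proof (intro conjI allI impI)
    show "col T j \<notin> mat_range B" if "j < n" for j
      using compl(1)[OF jsi[OF that]] col[OF that] by simp
    show "col T i \<noteq> c \<cdot>\<^sub>v col T j" if "i < n" "j < n" "i \<noteq> j \<and> c \<noteq> 0" for i j c
      using compl(2)[OF jsi[OF that(1)] jsi[OF that(2)]] col that js nth_eq_iff_index_eq by metis
  qed (use B r T' in auto)
qed

text \<open>
  A linear bijection \<open>G\<close> carries the hyperplane of block effects of the given RME design to the range
  of \<open>B\<close>. The images of the columns of \<open>T'\<close> then lie outside of the range of \<open>B\<close>, so each of them is
  proportional to a column of \<open>M\<close>; those columns of \<open>M\<close> form the projection design.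
\<close>

lemma RME_equivalent_projection_design:
  fixes M B B' T' :: "'a::{field,finite} mat"
  assumes B: "B \<in> carrier_mat (Suc d) d" and r: "vec_space.rank (Suc d) B = d"
    and rep: "represents_points (Suc d) M (proj_points (Suc d) - {P \<in> proj_points (Suc d). P \<subseteq> mat_range B})"
    and RME: "(T', B') \<in> RME_designs (Suc d) n d"
  obtains T where "T \<in> projection_designs (Suc d) n M" and "\<And>i. A0 T i = A0 T' i"
proof -
  let ?m = "Suc d"
  note compl = hyperplane_complement_columns[OF B rep]
  have M: "dim_row M = ?m" using rep by (simp add: represents_points_def)
  have T'reg: "T' \<in> regular_generators ?m n" and B': "B' \<in> carrier_mat ?m d" and r': "vec_space.rank ?m B' = d"
    and out': "\<And>j. j < n \<Longrightarrow> col T' j \<notin> mat_range B'"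
    and ind': "\<And>i j c. i < n \<Longrightarrow> j < n \<Longrightarrow> i \<noteq> j \<Longrightarrow> c \<noteq> 0 \<Longrightarrow> col T' i \<noteq> c \<cdot>\<^sub>v col T' j"
    using RME by (auto simp: RME_designs_iff)
  have T': "T' \<in> carrier_mat ?m n" using T'reg by (simp add: regular_generators_def)
  obtain P Q where P: "P \<in> carrier_mat ?m ?m" and Q: "Q \<in> carrier_mat ?m ?m"
    and PQ: "P * Q = 1\<^sub>m ?m" "Q * P = 1\<^sub>m ?m"
    and range: "\<And>x. x \<in> carrier_vec ?m \<Longrightarrow> x \<in> mat_range B \<longleftrightarrow> (Q *\<^sub>v x) $ d = 0"
    by (rule hyperplane_coordinates[OF B r]) (rule that)
  obtain P' Q' where P': "P' \<in> carrier_mat ?m ?m" and Q': "Q' \<in> carrier_mat ?m ?m"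
    and PQ': "P' * Q' = 1\<^sub>m ?m" "Q' * P' = 1\<^sub>m ?m"
    and range': "\<And>x. x \<in> carrier_vec ?m \<Longrightarrow> x \<in> mat_range B' \<longleftrightarrow> (Q' *\<^sub>v x) $ d = 0"
    by (rule hyperplane_coordinates[OF B' r']) (rule that)
  \<comment> \<open>\<open>Q'\<close> takes the range of \<open>B'\<close> to the vectors with last coordinate \<open>0\<close>, and \<open>P\<close> takes these to the range of \<open>B\<close>.\<close>
  define G where "G = P * Q'"
  define H where "H = P' * Q"
  have G: "G \<in> carrier_mat ?m ?m" and H: "H \<in> carrier_mat ?m ?m"
    using P Q P' Q' by (auto simp: G_def H_def)
  have Gv: "G *\<^sub>v x = P *\<^sub>v (Q' *\<^sub>v x)"
    if "x \<in> carrier_vec ?m" for x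
    using that assoc_mult_mat_vec[OF P Q'] by (auto simp: G_def)
  have HG: "H * G = 1\<^sub>m ?m"
  proof -
    have "H * G = P' * (Q * (P * Q'))" unfolding G_def H_def using P Q P' Q' by (simp add: assoc_mult_mat[of _ ?m ?m _ ?m _ ?m])
    also have "Q * (P * Q') = Q'" using assoc_mult_mat[OF Q P Q'] PQ Q' by simp
    finally show ?thesis using PQ' by simp
  qed
  have GH: "G * H = 1\<^sub>m ?m"
    using mat_mult_left_right_inverse[OF H G HG] .
  have out: "G *\<^sub>v col T' j \<notin> mat_range B" if j: "j < n" for j
  proof -
    have c: "col T' j \<in> carrier_vec ?m" using T' j by simp
    then have "Q *\<^sub>v (G *\<^sub>v col T' j) = Q' *\<^sub>v col T' j"
      using inverse_mult_vec[OF Q P PQ(2)] Q' Gv by simp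
    then show ?thesis
      using range[of "G *\<^sub>v col T' j"] range'[OF c] out'[OF j] G c by (metis mult_mat_vec_carrier)
  qed
  have "\<forall>j\<in>{..<n}. \<exists>kc. fst kc < dim_col M \<and> snd kc \<noteq> 0 \<and>
      col M (fst kc) = snd kc \<cdot>\<^sub>v (G *\<^sub>v col T' j)"
  proof
    fix j assume "j \<in> {..<n}"
    then have j: "j < n" by simp
    have "G *\<^sub>v col T' j \<in> carrier_vec ?m" using G T' j by simp
    from compl(3)[OF this out[OF j]] obtain k c where
      "k < dim_col M" "c \<noteq> 0" "col M k = c \<cdot>\<^sub>v (G *\<^sub>v col T' j)" by blast
    then show "\<exists>kc. fst kc < dim_col M \<and> snd kc \<noteq> 0 \<and> col M (fst kc) = snd kc \<cdot>\<^sub>v (G *\<^sub>v col T' j)"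
      by (intro exI[of _ "(k, c)"]) simp
  qed
  from bchoice[OF this] obtain f where f: "\<forall>j\<in>{..<n}. fst (f j) < dim_col M \<and> snd (f j) \<noteq> 0 \<and>
      col M (fst (f j)) = snd (f j) \<cdot>\<^sub>v (G *\<^sub>v col T' j)" ..
  define \<kappa> q where "\<kappa> = fst \<circ> f" and "q = snd \<circ> f"
  have \<kappa>: "\<And>j. j < n \<Longrightarrow> \<kappa> j < dim_col M" and q: "\<And>j. j < n \<Longrightarrow> q j \<noteq> 0"
    and col: "\<And>j. j < n \<Longrightarrow> col M (\<kappa> j) = q j \<cdot>\<^sub>v (G *\<^sub>v col T' j)"
    using f unfolding \<kappa>_def q_def o_apply by blast+
  define T where "T = mat_of_cols ?m (map (\<lambda>j. col M (\<kappa> j)) [0..<n])"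
  have T: "T \<in> carrier_mat ?m n" unfolding T_def by (intro carrier_matI) simp_all
  have colT: "col T j = col M (\<kappa> j)" if "j < n" for j
    using that col_dim[of M "\<kappa> j"] unfolding T_def M by (subst col_mat_of_cols) simp_all
  have inj: "inj_on \<kappa> {..<n}"
  proof (rule inj_onI, rule ccontr)
    fix i j assume ij: "i \<in> {..<n}" "j \<in> {..<n}" "\<kappa> i = \<kappa> j" "i \<noteq> j"
    have c: "col T' i \<in> carrier_vec ?m" "col T' j \<in> carrier_vec ?m" using T' ij by auto
    have "q i \<cdot>\<^sub>v (G *\<^sub>v col T' i) = q j \<cdot>\<^sub>v (G *\<^sub>v col T' j)"
      using col[of i] col[of j] ij by simp
    then have "G *\<^sub>v (q i \<cdot>\<^sub>v col T' i) = G *\<^sub>v (q j \<cdot>\<^sub>v col T' j)"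
      using mult_mat_vec[OF G] c by simp
    then have "q i \<cdot>\<^sub>v col T' i = q j \<cdot>\<^sub>v col T' j"
      using inverse_mult_vec[OF H G HG] c by (metis smult_carrier_vec)
    then have "inverse (q i) \<cdot>\<^sub>v (q i \<cdot>\<^sub>v col T' i) = inverse (q i) \<cdot>\<^sub>v (q j \<cdot>\<^sub>v col T' j)"
      by simp
    moreover have "inverse (q i) \<cdot>\<^sub>v (q i \<cdot>\<^sub>v col T' i) = col T' i"
      using q[of i] ij by (intro eq_vecI) auto
    moreover have "inverse (q i) \<cdot>\<^sub>v (q j \<cdot>\<^sub>v col T' j) = (q j / q i) \<cdot>\<^sub>v col T' j"
      by (intro eq_vecI) (auto simp: field_simps)
    ultimately show False
      using ind'[of i j "q j / q i"] ij q by simp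
  qed
  have colGT: "col T j = q j \<cdot>\<^sub>v (G *\<^sub>v col T' j)" if "j < n" for j
    using colT[OF that] col[OF that] by simp
  have "T \<in> projection_designs ?m n M"
    unfolding projection_designs_iff[OF M]
  proof (intro conjI exI[of _ "map \<kappa> [0..<n]"])
    show "T \<in> regular_generators ?m n"
      using regular_generators_scaled_columns[OF T'reg T G H GH q colGT] .
    show "distinct (map \<kappa> [0..<n])"
      using inj by (simp add: distinct_map atLeast0LessThan)
  qed (use \<kappa> colT in auto)
  moreover have "A0 T i = A0 T' i" for i
    using A0_scaled_columns[OF T' T G H HG q colGT] .
  ultimately show ?thesis using that by blast
qed

section \<open>Blocks\<close>

lemma set_rows_code_matrix:
  fixes T :: "'a::{field,finite} mat"
  shows "set (rows (code_matrix T)) = (\<lambda>u. vec_times_mat u T) ` carrier_vec (dim_row T)"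
proof -
  have "set (map (\<lambda>u. vec_times_mat u T) (enum_list (carrier_vec (dim_row T)))) \<subseteq> carrier_vec (dim_col T)"
    unfolding vec_times_mat_def by (auto intro!: carrier_vecI)
  from rows_mat_of_rows[OF this] show ?thesis
    using enum_list_props(2)[of "carrier_vec (dim_row T) :: 'a vec set"] by (simp add: code_matrix_def)
qed

lemma blocks_partition:
  fixes T B :: "'a::{field,finite} mat"
  assumes T: "T \<in> regular_generators m n" and B: "B \<in> carrier_mat m p"
    and surj: "\<And>v. v \<in> carrier_vec p \<Longrightarrow> \<exists>u\<in>carrier_vec m. vec_times_mat u B = v"
  shows "partition_on (set (rows (code_matrix T))) (blocks (T, B))"
    and "card (blocks (T, B)) = CARD('a) ^ p"
proof -
  have Tc: "T \<in> carrier_mat m n" and inj: "inj_on (\<lambda>u. vec_times_mat u T) (carrier_vec m)"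
    using T full_row_rank_imp_transpose_inj by (auto simp: regular_generators_def)
  define block where "block v = (\<lambda>u. vec_times_mat u T) ` {u \<in> carrier_vec m. vec_times_mat u B = v}" for v
  have blocks: "blocks (T, B) = block ` carrier_vec p"
    using Tc B unfolding blocks_def block_def by (auto simp: image_def)
  have ne: "block v \<noteq> {}" if "v \<in> carrier_vec p" for v
    using surj[OF that] by (auto simp: block_def)
  have disj: "block v \<inter> block w = {}" if "v \<noteq> w" for v w
  proof (rule ccontr)
    assume "block v \<inter> block w \<noteq> {}"
    then obtain u u' where "u \<in> carrier_vec m" "vec_times_mat u B = v" "u' \<in> carrier_vec m"
      "vec_times_mat u' B = w" "vec_times_mat u T = vec_times_mat u' T"
      unfolding block_def by blast
    then show False using that inj_onD[OF inj] by metis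
  qed
  show "partition_on (set (rows (code_matrix T))) (blocks (T, B))"
    unfolding blocks
  proof (rule partition_onI)
    have "vec_times_mat u B \<in> carrier_vec p" for u :: "'a vec"
      unfolding vec_times_mat_def using B by (intro carrier_vecI) simp
    then show "\<Union> (block ` carrier_vec p) = set (rows (code_matrix T))"
      unfolding set_rows_code_matrix block_def using Tc by auto
    show "disjnt X Y" if "X \<in> block ` carrier_vec p" "Y \<in> block ` carrier_vec p" "X \<noteq> Y" for X Y
      using that disj unfolding disjnt_def by (metis imageE)
    show "{} \<notin> block ` carrier_vec p" using ne by fastforce
  qed
  have "inj_on block (carrier_vec p)"
    using ne disj by (intro inj_onI) (metis Int_absorb)
  then show "card (blocks (T, B)) = CARD('a) ^ p"
    unfolding blocks by (simp add: card_image card_carrier_vec)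
qed

section \<open>Comparison of the minimum aberration criteria\<close>

text \<open>
  The lexicographic order is total, so it suffices that the order by \<open>W\<close> agrees with the order by \<open>a\<close>
  whenever the latter is strict, and that equal \<open>a\<close> gives equal \<open>W\<close>.
\<close>

lemma lex_minimizes_transfer:
  fixes a W :: "'d \<Rightarrow> nat \<Rightarrow> real"
  assumes min: "lex_minimizes a C D"
    and strict: "\<And>D1 D2 k. D1 \<in> C \<Longrightarrow> D2 \<in> C \<Longrightarrow> a D1 k < a D2 k \<Longrightarrow>
      (\<And>k'. k' < k \<Longrightarrow> a D1 k' = a D2 k') \<Longrightarrow> less_fun (W D1) (W D2)"
    and cong: "\<And>D1 D2. D1 \<in> C \<Longrightarrow> D2 \<in> C \<Longrightarrow> a D1 = a D2 \<Longrightarrow> W D1 = W D2"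
  shows "lex_minimizes W C D"
  unfolding lex_minimizes_def
proof (intro conjI ballI)
  show D: "D \<in> C" using min by (simp add: lex_minimizes_def)
  fix D' assume D': "D' \<in> C"
  have nl: "\<not> less_fun (a D') (a D)" using min D' by (simp add: lex_minimizes_def)
  show "\<not> less_fun (W D') (W D)"
  proof (cases "a D' = a D")
    case True
    then show ?thesis using cong[OF D' D] by (simp add: less_fun_def)
  next
    case False
    then have "\<exists>k. a D' k \<noteq> a D k" by auto
    then obtain k where k: "a D' k \<noteq> a D k" and least: "\<And>k'. k' < k \<Longrightarrow> a D' k' = a D k'"
      using exists_least_iff[of "\<lambda>k. a D' k \<noteq> a D k"] by blast
    have "\<not> a D' k < a D k" using nl least by (auto simp: less_fun_def)
    then have "a D k < a D' k" using k by simp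
    from strict[OF D D' this] have "less_fun (W D) (W D')" using least by simp
    then show ?thesis by (rule less_fun_asym)
  qed
qed

lemma nth_mod2: "[x, y] ! (j mod 2) = (if even j then x else y)"
  by (auto simp: mod2_eq_if)

lemma nth_mod3: "[x, y, z] ! (j mod 3) = (if j mod 3 = 0 then x else if j mod 3 = 1 then y else z)"
proof -
  have "j mod 3 < 3" by simp
  then have "j mod 3 = 0 \<or> j mod 3 = 1 \<or> j mod 3 = 2" by linarith
  then show ?thesis by auto
qed

text \<open>
  As \<open>A1\<close> is the same function \<open>z\<close> minus \<open>A0\<close> for both designs, only \<open>A0\<close> distinguishes them. In each
  of the four sequences and for every \<open>i \<ge> 3\<close>, the term containing \<open>A0\<close> at \<open>i\<close>, with a positive
  coefficient, precedes the one containing \<open>A1\<close> at \<open>i\<close>. So if \<open>r \<ge> 3\<close> is the first index at which the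
  two functions \<open>A0\<close> differ, then the term containing \<open>A0\<close> at \<open>r\<close> is the first one at which the
  sequences differ, and it decides in the same direction.
\<close>

locale complementary_words =
  fixes T1 B1 T2 B2 :: "'a::{field,finite} mat" and z :: "nat \<Rightarrow> real"
  assumes A1: "\<And>i. A1 T1 B1 i = z i - A0 T1 i" "\<And>i. A1 T2 B2 i = z i - A0 T2 i"
begin

lemma W_eq:
  assumes "\<And>i. i \<ge> 1 \<Longrightarrow> A0 T1 i = A0 T2 i"
  shows "W_scf (T1, B1) = W_scf (T2, B2)" and "W_1 (T1, B1) = W_1 (T2, B2)"
    and "W_2 (T1, B1) = W_2 (T2, B2)" and "W_cc (T1, B1) = W_cc (T2, B2)"
  using assms by (auto simp: W_scf_def W_1_def W_2_def W_cc_def Let_def A1 fun_eq_iff nth_mod2 nth_mod3)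

context
  fixes r :: nat
  assumes r: "r \<ge> 3" and less: "A0 T1 r < A0 T2 r" and eq: "\<And>i. i \<ge> 1 \<Longrightarrow> i < r \<Longrightarrow> A0 T1 i = A0 T2 i"
begin

lemma W_scf_less: "less_fun (W_scf (T1, B1)) (W_scf (T2, B2))"
proof (rule less_funI, intro exI conjI allI impI)
  have "2 * (r - 3) div 2 + 2 + 1 = r" using r by simp
  then show "W_scf (T1, B1) (2 * (r - 3)) < W_scf (T2, B2) (2 * (r - 3))"
    using less by (simp add: W_scf_def Let_def nth_mod2)
  fix j assume "j < 2 * (r - 3)"
  then have "j div 2 + 3 < r" by linarith
  then show "W_scf (T1, B1) j = W_scf (T2, B2) j"
    by (simp add: W_scf_def Let_def nth_mod2 A1 eq)
qed

lemma parity_cases: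
  obtains (odd) i where "r = Suc (Suc (Suc (2 * i)))" | (even) i where "r = 2 * i + 4"
proof (cases "even r")
  case True
  then obtain i where "r = 2 * i" by blast
  with r even[of "i - 2"] show ?thesis by simp
next
  case False
  then obtain i where "r = 2 * i + 1" by (elim oddE)
  with r odd[of "i - 1"] show ?thesis by simp
qed

lemma W_1_less: "less_fun (W_1 (T1, B1)) (W_1 (T2, B2))"
proof (cases rule: parity_cases)
  case (odd i)
  show ?thesis
  proof (rule less_funI, intro exI conjI allI impI)
    show "W_1 (T1, B1) (3 * i) < W_1 (T2, B2) (3 * i)"
      using less odd by (simp add: W_1_def Let_def nth_mod3)
    fix j assume "j < 3 * i"
    then have "j div 3 < i" by (simp add: less_mult_imp_div_less mult.commute)
    then have "2 * (j div 3 + 2) < r" using odd by simp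
    then show "W_1 (T1, B1) j = W_1 (T2, B2) j"
      by (simp add: W_1_def Let_def nth_mod3 A1 eq)
  qed
next
  case (even i)
  show ?thesis
  proof (rule less_funI, intro exI conjI allI impI)
    have "(3 * i + 1) div 3 = i" "(3 * i + 1) mod 3 = 1" by presburger+
    moreover have r_eq: "Suc (Suc (Suc (Suc (2 * i)))) = r" using even by simp
    ultimately show "W_1 (T1, B1) (3 * i + 1) < W_1 (T2, B2) (3 * i + 1)"
      using less by (simp add: W_1_def Let_def nth_mod3 r_eq)
    fix j assume "j < 3 * i + 1"
    then have "j div 3 < i \<or> j = 3 * i" using even by linarith
    then show "W_1 (T1, B1) j = W_1 (T2, B2) j"
      using even by (auto simp add: W_1_def Let_def nth_mod3 A1 eq)
  qed
qed

lemma W_2_less: "less_fun (W_2 (T1, B1)) (W_2 (T2, B2))"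
proof (cases rule: parity_cases)
  case (odd i)
  show ?thesis
  proof (rule less_funI, intro exI conjI allI impI)
    show "W_2 (T1, B1) (3 * i) < W_2 (T2, B2) (3 * i)"
      using less odd by (simp add: W_2_def Let_def nth_mod3)
    fix j assume "j < 3 * i"
    then have "j div 3 < i" by (simp add: less_mult_imp_div_less mult.commute)
    then have "2 * (j div 3 + 2) < r" using odd by simp
    then show "W_2 (T1, B1) j = W_2 (T2, B2) j"
      by (simp add: W_2_def Let_def nth_mod3 A1 eq)
  qed
next
  case (even i)
  show ?thesis
  proof (rule less_funI, intro exI conjI allI impI)
    have "(3 * i + 2) div 3 = i" "(3 * i + 2) mod 3 = 2" by presburger+
    moreover have r_eq: "Suc (Suc (Suc (Suc (2 * i)))) = r" using even by simp
    ultimately show "W_2 (T1, B1) (3 * i + 2) < W_2 (T2, B2) (3 * i + 2)"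
      using less by (simp add: W_2_def Let_def nth_mod3 r_eq)
    fix j assume j: "j < 3 * i + 2"
    show "W_2 (T1, B1) j = W_2 (T2, B2) j"
    proof (cases "j mod 3 = 2")
      case True
      then have "j div 3 < i" using j div_mult_mod_eq[of j 3] by linarith
      then have "2 * (j div 3 + 2) < r" using even by simp
      with True show ?thesis by (simp add: W_2_def Let_def nth_mod3 eq)
    next
      case False
      have "j div 3 \<le> i" using j div_mult_mod_eq[of j 3] by linarith
      then have "2 * (j div 3 + 2) \<le> r" using even by simp
      with False show ?thesis by (simp add: W_2_def Let_def nth_mod3 A1 eq)
    qed
  qed
qed

lemma W_cc_less: "less_fun (W_cc (T1, B1)) (W_cc (T2, B2))"
proof (cases rule: parity_cases)
  case (odd i)
  show ?thesis
  proof (rule less_funI, intro exI conjI allI impI)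
    \<comment> \<open>\<open>A1\<close> at \<open>i + 2\<close> shares a term with \<open>A0\<close> at \<open>r = 2 (i + 2) - 1\<close>, but \<open>i + 2 < r\<close>.\<close>
    have "A0 T1 (i + 2) = A0 T2 (i + 2)" using odd by (intro eq) auto
    moreover have "0 < real (r choose (i + 2))"
      using odd by (simp del: binomial_Suc_Suc)
    from mult_strict_left_mono[OF less this]
    have "real (r choose (i + 2)) * A0 T1 r < real (r choose (i + 2)) * A0 T2 r" .
    ultimately show "W_cc (T1, B1) (2 * i) < W_cc (T2, B2) (2 * i)"
      using odd by (simp add: W_cc_def Let_def nth_mod2 A1 del: binomial_Suc_Suc)
    fix j assume "j < 2 * i"
    then have "j div 2 < i" by (simp add: less_mult_imp_div_less mult.commute)
    then have "2 * (j div 2 + 2) < r" using odd by simp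
    then show "W_cc (T1, B1) j = W_cc (T2, B2) j"
      by (simp add: W_cc_def Let_def nth_mod2 A1 eq)
  qed
next
  case (even i)
  show ?thesis
  proof (rule less_funI, intro exI conjI allI impI)
    have r_eq: "Suc (Suc (Suc (Suc (2 * i)))) = r" using even by simp
    show "W_cc (T1, B1) (2 * i + 1) < W_cc (T2, B2) (2 * i + 1)"
      using less by (simp add: W_cc_def Let_def nth_mod2 r_eq)
    fix j assume j: "j < 2 * i + 1"
    show "W_cc (T1, B1) j = W_cc (T2, B2) j"
    proof (cases "even j")
      case True
      have "j div 2 \<le> i" using j by linarith
      then have "2 * (j div 2 + 2) \<le> r" using even by simp
      with True show ?thesis by (simp add: W_cc_def Let_def nth_mod2 A1 eq)
    next
      case False
      then have "2 * (j div 2 + 2) < r" using j even by (elim oddE) simp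
      with False show ?thesis by (simp add: W_cc_def Let_def nth_mod2 eq)
    qed
  qed
qed

end

end

text \<open>
  The designs of the class satisfy \<open>A0 T 1 = A0 T 2 = 0\<close>, so a first difference occurs at an index
  that is at least \<open>3\<close>.
\<close>

lemma RME_MA_of_A0_minimal:
  fixes D :: "'a::{field,finite} mat \<times> 'a mat"
  assumes min: "lex_minimizes (\<lambda>(T, B) j. A0 T (j + 1)) (RME_designs (Suc d) n d) D"
  shows "RME_MA W_scf (Suc d) n d D" and "RME_MA W_1 (Suc d) n d D"
    and "RME_MA W_2 (Suc d) n d D" and "RME_MA W_cc (Suc d) n d D"
proof -
  let ?C = "RME_designs (Suc d) n d :: ('a mat \<times> 'a mat) set"
  let ?a = "\<lambda>(T, B) j. A0 T (j + 1) :: real"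
  have A: "complementary_words (fst D1) (snd D1) (fst D2) (snd D2) (zero_sum_count TYPE('a) n)"
    if "D1 \<in> ?C" "D2 \<in> ?C" for D1 D2
    using A1_eq_of_RME[of "fst D1" "snd D1" d n] A1_eq_of_RME[of "fst D2" "snd D2" d n] that
    by unfold_locales simp_all
  have first: "k + 1 \<ge> 3 \<and> A0 (fst D1) (k + 1) < A0 (fst D2) (k + 1) \<and>
      (\<forall>i\<ge>1. i < k + 1 \<longrightarrow> A0 (fst D1) i = A0 (fst D2) i)"
    if D: "D1 \<in> ?C" "D2 \<in> ?C" and k: "?a D1 k < ?a D2 k" and eq: "\<And>k'. k' < k \<Longrightarrow> ?a D1 k' = ?a D2 k'"
    for D1 D2 k
  proof (intro conjI allI impI)
    have z: "A0 (fst D1) 1 = 0" "A0 (fst D1) 2 = 0" "A0 (fst D2) 1 = 0" "A0 (fst D2) 2 = 0"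
      using D by (auto simp: RME_designs_def)
    have "k \<noteq> 0" using k z by (cases k) (auto simp: case_prod_beta)
    moreover have "k \<noteq> 1" using k z by (auto simp: case_prod_beta numeral_2_eq_2)
    ultimately show "k + 1 \<ge> 3" by simp
    show "A0 (fst D1) (k + 1) < A0 (fst D2) (k + 1)" using k by (simp add: case_prod_beta)
    show "A0 (fst D1) i = A0 (fst D2) i" if "i \<ge> 1" "i < k + 1" for i
      using eq[of "i - 1"] that by (simp add: case_prod_beta)
  qed
  have eq: "A0 (fst D1) i = A0 (fst D2) i" if "?a D1 = ?a D2" "i \<ge> 1" for D1 D2 :: "'a mat \<times> 'a mat" and i
    using fun_cong[OF that(1), of "i - 1"] that(2) by (simp add: case_prod_beta)
  have transfer: "lex_minimizes W ?C D"
    if "\<And>D1 D2 r. D1 \<in> ?C \<Longrightarrow> D2 \<in> ?C \<Longrightarrow> r \<ge> 3 \<Longrightarrow> A0 (fst D1) r < A0 (fst D2) r \<Longrightarrow>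
        (\<And>i. i \<ge> 1 \<Longrightarrow> i < r \<Longrightarrow> A0 (fst D1) i = A0 (fst D2) i) \<Longrightarrow> less_fun (W D1) (W D2)"
      and "\<And>D1 D2. D1 \<in> ?C \<Longrightarrow> D2 \<in> ?C \<Longrightarrow> (\<And>i. i \<ge> 1 \<Longrightarrow> A0 (fst D1) i = A0 (fst D2) i) \<Longrightarrow> W D1 = W D2"
    for W :: "'a mat \<times> 'a mat \<Rightarrow> nat \<Rightarrow> real"
    using min
  proof (rule lex_minimizes_transfer)
    fix D1 D2 k assume *: "D1 \<in> ?C" "D2 \<in> ?C" "?a D1 k < ?a D2 k" "\<And>k'. k' < k \<Longrightarrow> ?a D1 k' = ?a D2 k'"
    from that(1)[OF *(1,2)] first[OF *] show "less_fun (W D1) (W D2)" by blast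
  next
    fix D1 D2 assume *: "D1 \<in> ?C" "D2 \<in> ?C" "?a D1 = ?a D2"
    from that(2)[OF *(1,2)] eq[OF *(3)] show "W D1 = W D2" by blast
  qed
  show "RME_MA W_scf (Suc d) n d D"
    unfolding RME_MA_def
    by (rule transfer; (rule complementary_words.W_scf_less[OF A, unfolded prod.collapse]
      | rule complementary_words.W_eq(1)[OF A, unfolded prod.collapse]); assumption)
  show "RME_MA W_1 (Suc d) n d D"
    unfolding RME_MA_def
    by (rule transfer; (rule complementary_words.W_1_less[OF A, unfolded prod.collapse]
      | rule complementary_words.W_eq(2)[OF A, unfolded prod.collapse]); assumption)
  show "RME_MA W_2 (Suc d) n d D"
    unfolding RME_MA_def
    by (rule transfer; (rule complementary_words.W_2_less[OF A, unfolded prod.collapse]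
      | rule complementary_words.W_eq(3)[OF A, unfolded prod.collapse]); assumption)
  show "RME_MA W_cc (Suc d) n d D"
    unfolding RME_MA_def
    by (rule transfer; (rule complementary_words.W_cc_less[OF A, unfolded prod.collapse]
      | rule complementary_words.W_eq(4)[OF A, unfolded prod.collapse]); assumption)
qed

section \<open>Minimum aberration of the blocked design\<close>

theorem theorem5:
  fixes n k :: nat
    and \<Phi> :: "'a::{field,finite} vec set set"
    and Tt T :: "'a mat"
  assumes "n \<ge> 1" and "n - k \<ge> 2"
    and "is_flat (n - k) (n - k - 2) \<Phi>"
    and "represents_points (n - k) Tt (proj_points (n - k) - \<Phi>)"
    and "T \<in> projection_designs (n - k) n Tt"
    and "regular_MA (projection_designs (n - k) n Tt) T"
  shows "\<exists>B. (T, B) \<in> RME_designs (n - k) n (n - k - 1) \<and>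
           partition_on (set (rows (code_matrix T))) (blocks (T, B)) \<and>
           card (blocks (T, B)) = CARD('a) ^ (n - k - 1) \<and>
           RME_MA W_scf (n - k) n (n - k - 1) (T, B) \<and>
           RME_MA W_1 (n - k) n (n - k - 1) (T, B) \<and>
           RME_MA W_2 (n - k) n (n - k - 1) (T, B) \<and>
           RME_MA W_cc (n - k) n (n - k - 1) (T, B)"
proof -
  define d where "d = n - k - 1"
  have d: "n - k = Suc d" "Suc d - 1 = d" "Suc d - 2 + 1 = d"
    using assms(2) by (simp_all add: d_def)
  \<comment> \<open>The blocking matrix is a basis of the hyperplane \<open>W\<close> underlying \<open>\<Phi>\<close>.\<close>
  obtain W where W: "VectorSpace.subspace class_ring W (module_vec TYPE('a) (Suc d))"
    "vectorspace.dim class_ring (module_vec TYPE('a) (Suc d)\<lparr>carrier := W\<rparr>) = d"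
    "\<Phi> = {P \<in> proj_points (Suc d). P \<subseteq> W}"
    using assms(3) unfolding is_flat_def d by blast
  obtain B where B: "B \<in> carrier_mat (Suc d) d" and r: "vec_space.rank (Suc d) B = d" and W': "mat_range B = W"
    using subspace_eq_mat_range[OF W(1,2)] .
  have rep: "represents_points (Suc d) Tt (proj_points (Suc d) - {P \<in> proj_points (Suc d). P \<subseteq> mat_range B})"
    using assms(4) unfolding d W' W(3) .
  have T: "T \<in> projection_designs (Suc d) n Tt" using assms(5) unfolding d .
  have RME: "(T, B) \<in> RME_designs (Suc d) n d"
    using projection_design_is_RME[OF B r rep T] .
  have "lex_minimizes (\<lambda>(T, B) j. A0 T (j + 1)) (RME_designs (Suc d) n d) (T, B)"
    unfolding lex_minimizes_def
  proof (intro conjI ballI RME)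
    fix D' :: "'a mat \<times> 'a mat" assume "D' \<in> RME_designs (Suc d) n d"
    then obtain T' B' where D': "D' = (T', B')" "(T', B') \<in> RME_designs (Suc d) n d"
      by (cases D') auto
    obtain T'' where T'': "T'' \<in> projection_designs (Suc d) n Tt" and A0: "\<And>i. A0 T'' i = A0 T' i"
      using RME_equivalent_projection_design[OF B r rep D'(2)] by blast
    have "\<not> less_fun (\<lambda>j. A0 T'' (j + 1)) (\<lambda>j. A0 T (j + 1))"
      using assms(6) T'' unfolding regular_MA_def lex_minimizes_def d by blast
    then show "\<not> less_fun (case D' of (T, B) \<Rightarrow> \<lambda>j. A0 T (j + 1)) (case (T, B) of (T, B) \<Rightarrow> \<lambda>j. A0 T (j + 1))"
      by (simp add: D'(1) A0)
  qed
  note MA = RME_MA_of_A0_minimal[OF this]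
  have "T \<in> regular_generators (Suc d) n" using RME by (simp add: RME_designs_iff)
  note blocks = blocks_partition[OF this B]
  have "\<exists>u\<in>carrier_vec (Suc d). vec_times_mat u B = v" if "v \<in> carrier_vec d" for v
    using hyperplane_transpose_surj[OF B r that] by blast
  then show ?thesis
    unfolding d using RME MA blocks by blast
qed

end
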